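(* Let $M$ be a random set admitting an honest indexation $\tau$ and let $S$ be an $(\mathcal{F}_{-\infty,t})_{t\in\mathbb{R}}$-stopping time (meaning: $S$ is $[-\infty,\infty]$-valued and $\{S\le a\}\in\mathcal{F}_{-\infty,a}$ for all $a\in\mathbb{R}$). Then $\mathsf{W}(S\in M)=0$.
   Context: $\Omega_0:=\{\omega:\mathbb{R}\to\mathbb{R}\text{ continuous},\ \omega(0)=0\}$, with canonical process $B=(B_t)_{t\in\mathbb{R}}$. $\mathsf{W}$ is the completed two-sided Wiener measure: $(B_t)_{t\ge0}$ and $(B_{-t})_{t\ge 0}$ are independent standard Brownian motions under $\mathsf{W}$. For extended-real $s<t$, $\mathcal{F}_{s,t}$ is the $\sigma$-field generated by the increments of $B$ between the times $s$ and $t$ and by all events of $\mathsf{W}$-probability $0$ or $1$. For $u\in\mathbb{R}$ the Lévy shift is $\Delta_u(\omega)(t):=\omega(u+t)-\omega(u)$. $\mathbb{R}^\dagger:=\mathbb{R}\cup\{\dagger\}$ with $\dagger\notin\mathbb{R}$ a coffin state, endowed with the $\sigma$-field generated by the Borel sets of $\mathbb{R}$ and $\{\dagger\}$; $u+\dagger:=\dagger$. A random set is a map $M:\Omega_0\to2^{\mathbb{R}}$. An honest indexation for a random set $M$ is a family $\tau=(\tau_{s,t})_{(s,t)\in\mathbb{R}^2,s<t}$ of $\mathcal{F}_{-\infty,\infty}$-measurable $\mathbb{R}^\dagger$-valued maps such that ($\mathsf{W}$-a.s. understood): (inclusion) $\tau_{s,t}\in M$ a.s. for all real $s<t$; (exhaustion)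 $M=\{\tau_{s,t}:(s,t)\in\mathbb{Q}^2,s<t\}$ a.s.; (locality) $\tau_{s,t}$ is a.s. valued in $(s,t)$ and is $\mathcal{F}_{s,t}$-measurable for all real $s<t$; (stationarity) $\tau_{s+h,t+h}=h+\tau_{s,t}(\Delta_h)$ a.s. for all real $h$ and $s<t$; (nestedness) $\tau_{s,t}=\tau_{u,v}$ a.s. on $\{\tau_{s,t}\in(u,v)\}$ for all real $s\le u<v\le t$. *)

theory Defs
  imports "HOL-Probability.Probability"
begin

section \<open>Path space and the two-sided Wiener measure\<close>

definition Omega0 :: "(real \<Rightarrow> real) set" where
  "Omega0 = {\<omega>. continuous_on UNIV \<omega> \<and> \<omega> 0 = 0}"

text \<open>The \<open>\<sigma>\<close>-field on path space generated by the canonical process \<open>B\<^sub>t(\<omega>) = \<omega> t\<close>.\<close>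

definition path_space :: "(real \<Rightarrow> real) measure" where
  "path_space = restrict_space (\<Pi>\<^sub>M t\<in>UNIV. borel) Omega0"

text \<open>A standard Brownian motion with time set \<open>[0, \<infinity>)\<close>; the values \<open>X t\<close> at negative \<open>t\<close> are
  ignored. The second parameter of \<^const>\<open>normal_density\<close> is the standard deviation.\<close>

definition standard_brownian_motion :: "'a measure \<Rightarrow> (real \<Rightarrow> 'a \<Rightarrow> real) \<Rightarrow> bool" where
  "standard_brownian_motion P X \<longleftrightarrow>
     prob_space P \<and>
     (\<forall>t\<ge>0. X t \<in> borel_measurable P) \<and>
     (AE \<omega> in P. X 0 \<omega> = 0) \<and>
     (AE \<omega> in P. continuous_on {0..} (\<lambda>t. X t \<omega>)) \<and>
     (\<forall>s t. 0 \<le> s \<longrightarrow> s < t \<longrightarrow>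
        distributed P lborel (\<lambda>\<omega>. X t \<omega> - X s \<omega>) (normal_density 0 (sqrt (t - s)))) \<and>
     (\<forall>(n::nat) (r :: nat \<Rightarrow> real). 0 \<le> r 0 \<longrightarrow> strict_mono_on {..n} r \<longrightarrow>
        prob_space.indep_vars P (\<lambda>_. borel) (\<lambda>i \<omega>. X (r (Suc i)) \<omega> - X (r i) \<omega>) {..<n})"

text \<open>The completed two-sided Wiener measure. The conditions determine \<open>P\<close>, hence \<open>W\<close>,
  uniquely.\<close>

definition two_sided_wiener_measure :: "(real \<Rightarrow> real) measure \<Rightarrow> bool" where
  "two_sided_wiener_measure W \<longleftrightarrow>
     (\<exists>P. prob_space P \<and> sets P = sets path_space \<and> W = completion P \<and>
       standard_brownian_motion P (\<lambda>t \<omega>. \<omega> t) \<and>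
       standard_brownian_motion P (\<lambda>t \<omega>. \<omega> (- t)) \<and>
       prob_space.indep_var P
         (\<Pi>\<^sub>M t\<in>{0..}. borel) (\<lambda>\<omega>. \<lambda>t\<in>{0..}. \<omega> t)
         (\<Pi>\<^sub>M t\<in>{0..}. borel) (\<lambda>\<omega>. \<lambda>t\<in>{0..}. \<omega> (- t)))"

definition levy_shift :: "real \<Rightarrow> (real \<Rightarrow> real) \<Rightarrow> (real \<Rightarrow> real)" where
  "levy_shift u \<omega> = (\<lambda>t. \<omega> (u + t) - \<omega> u)"

text \<open>\<open>incr_field W s t\<close> is \<open>\<F>\<^bsub>s,t\<^esub>\<close>; only its underlying set and \<open>\<sigma>\<close>-field are meaningful.\<close>

definition incr_field :: "(real \<Rightarrow> real) measure \<Rightarrow> ereal \<Rightarrow> ereal \<Rightarrow> (real \<Rightarrow> real) measure" where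
  "incr_field W s t = sigma (space W)
     ({{\<omega> \<in> space W. \<omega> v - \<omega> u \<in> A} | u v A.
         s \<le> ereal u \<and> u \<le> v \<and> ereal v \<le> t \<and> A \<in> sets (borel :: real measure)}
      \<union> {A \<in> sets W. emeasure W A = 0 \<or> emeasure W A = 1})"

lemma space_incr_field [simp]: "space (incr_field W s t) = space W"
  by (simp add: incr_field_def space_measure_of_conv)

lemma sets_incr_field:
  "sets (incr_field W s t) = sigma_sets (space W)
     ({{\<omega> \<in> space W. \<omega> v - \<omega> u \<in> A} | u v A.
         s \<le> ereal u \<and> u \<le> v \<and> ereal v \<le> t \<and> A \<in> sets (borel :: real measure)}
      \<union> {A \<in> sets W. emeasure W A = 0 \<or> emeasure W A = 1})"
  unfolding incr_field_def by (rule sets_measure_of) (auto dest: sets.sets_into_space)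

definition stopping_time_incr :: "(real \<Rightarrow> real) measure \<Rightarrow> ((real \<Rightarrow> real) \<Rightarrow> ereal) \<Rightarrow> bool" where
  "stopping_time_incr W S \<longleftrightarrow>
     (\<forall>a::real. {\<omega> \<in> space W. S \<omega> \<le> ereal a} \<in> sets (incr_field W (-\<infinity>) (ereal a)))"

section \<open>Honest indexations\<close>

text \<open>The set \<open>\<real>\<^sup>\<dagger>\<close> is rendered as \<^typ>\<open>real option\<close>, with \<^term>\<open>None\<close> as the coffin
  state \<open>\<dagger>\<close>; then \<open>u + x\<close> becomes \<^term>\<open>map_option (\<lambda>y. u + y) x\<close>.\<close>

definition dagger_borel :: "real option measure" where
  "dagger_borel = sigma UNIV ({Some ` A | A. A \<in> sets borel} \<union> {{None}})"

text \<open>Only the values \<open>\<tau> s t\<close> with \<open>s < t\<close>, and only on \<^const>\<open>Omega0\<close>, are meaningful. The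
  conjuncts are, in order: measurability, inclusion, exhaustion, locality, stationarity
  and nestedness.\<close>

definition honest_indexation ::
  "(real \<Rightarrow> real) measure \<Rightarrow> ((real \<Rightarrow> real) \<Rightarrow> real set) \<Rightarrow>
   (real \<Rightarrow> real \<Rightarrow> (real \<Rightarrow> real) \<Rightarrow> real option) \<Rightarrow> bool" where
  "honest_indexation W M \<tau> \<longleftrightarrow>
     (\<forall>s t. s < t \<longrightarrow> \<tau> s t \<in> incr_field W (-\<infinity>) \<infinity> \<rightarrow>\<^sub>M dagger_borel) \<and>
     (\<forall>s t. s < t \<longrightarrow> (AE \<omega> in W. \<tau> s t \<omega> \<in> Some ` M \<omega>)) \<and>
     (AE \<omega> in W. Some ` M \<omega> = {\<tau> s t \<omega> | s t. s \<in> \<rat> \<and> t \<in> \<rat> \<and> s < t}) \<and>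
     (\<forall>s t. s < t \<longrightarrow>
        (AE \<omega> in W. \<tau> s t \<omega> \<in> Some ` {s<..<t}) \<and>
        \<tau> s t \<in> incr_field W (ereal s) (ereal t) \<rightarrow>\<^sub>M dagger_borel) \<and>
     (\<forall>h s t. s < t \<longrightarrow>
        (AE \<omega> in W. \<tau> (s + h) (t + h) \<omega> = map_option (\<lambda>x. h + x) (\<tau> s t (levy_shift h \<omega>)))) \<and>
     (\<forall>s u v t. s \<le> u \<longrightarrow> u < v \<longrightarrow> v \<le> t \<longrightarrow>
        (AE \<omega> in W. \<tau> s t \<omega> \<in> Some ` {u<..<v} \<longrightarrow> \<tau> s t \<omega> = \<tau> u v \<omega>))"

end

theory Submission
  imports Defs
begin

text \<open>
  All stopping times of the Brownian filtration are announced by their past, whereas on the event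
  \<open>u < S\<close> a hit \<open>S = \<tau> b a\<close> shortly after \<open>u\<close> must, by nestedness, be the value of \<open>\<tau> u (u + \<gamma>)\<close>, which is
  independent of the past of \<open>u\<close> and, by stationarity, unlikely to be close to \<open>u\<close>. So no hit can be
  announced.

  Announcement enters in a discrete form that avoids continuous-time martingales: partition
  \<open>(w, w']\<close> into \<open>n\<close> cells and let \<open>\<Psi>\<^sub>n\<close> be the sum over the cells of the indicator that \<open>S\<close> lies in the cell
  minus its conditional probability given the past of the cell. Then \<open>\<Psi>\<^sub>n\<close> has \<open>L\<^sup>2\<close>-norm at most 1, and
  \<open>\<Psi>\<^sub>n \<rightarrow> 0\<close> weakly in \<open>L\<^sup>2\<close>. The latter may be tested on Lipschitz functionals of finitely many
  increments, since changing the path on a single cell alters these very little.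
\<close>

text \<open>The subtracted conditional probabilities add up to a discrete compensator of the process
  that jumps at \<open>S\<close>. Weak convergence of \<open>\<Psi>\<^sub>n\<close> to 0 says that
  this compensator tends to the indicator itself, a form of predictability.

  The obstacle is that the event \<open>D\<close> of a hit may depend on the whole path, so
  \<open>\<Psi>\<^sub>n\<close> is not orthogonal to it on any cell. This is why the limit is needed
  for all events, and the \<open>L\<^sup>2\<close> bound serves to pass from cylinder functionals to
  arbitrary ones.

  Let \<open>D'\<close> be the part of \<open>D\<close> where \<open>S\<close> lies in the window.
  The expectation of \<open>\<Psi>\<^sub>n\<close> over \<open>D'\<close> is the probability of
  \<open>D'\<close> minus the compensator integrated over \<open>D'\<close>. In each cell the
  compensator lives on \<open>u < S\<close>, where \<open>u\<close> is the left end of the cell, and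
  there \<open>D'\<close> lies in an event independent of the past of \<open>u\<close>, of
  probability at most \<rho>. In the limit, \<open>D'\<close> has probability at most \<rho> times
  that of \<open>S\<close> lying in the window.

  This last factor is the gain: over many short windows the bounds add up to \<rho> and not to
  \<rho> times the number of windows, and \<rho> tends to 0 with the window length.\<close>

section \<open>Compensated indicators\<close>

context prob_space
begin

lemma integrable_bounded:
  fixes f :: "'a \<Rightarrow> real"
  assumes "f \<in> borel_measurable M" "\<And>x. \<bar>f x\<bar> \<le> C"
  shows "integrable M f"
  using assms by (intro integrable_const_bound[of f C]) auto

text \<open>\<open>real_cond_exp\<close> is controlled only almost everywhere. This version of the
  conditional probability of \<open>E\<close> satisfies its bounds at every point, so that later
  estimates stay pointwise. Vanishing off \<open>G\<close> is what later confines the compensator to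
  the paths on which the stopping time is still ahead.\<close>

lemma cond_prob_version:
  assumes sub: "subalgebra M F" and E: "E \<in> sets M" and G: "G \<in> sets F" "E \<subseteq> G"
  obtains p :: "'a \<Rightarrow> real"
  where "p \<in> borel_measurable F" "\<And>x. 0 \<le> p x" "\<And>x. p x \<le> 1" "\<And>x. x \<notin> G \<Longrightarrow> p x = 0"
    "\<And>f C. f \<in> borel_measurable F \<Longrightarrow> (\<And>x. \<bar>f x\<bar> \<le> C) \<Longrightarrow>
       expectation (\<lambda>x. p x * f x) = expectation (\<lambda>x. indicator E x * f x)"
proof -
  interpret finite_measure_subalgebra M F by unfold_locales (fact sub)
  define q where "q = real_cond_exp M F (indicator E)"
  \<comment> \<open>Clipping changes \<open>q\<close> on a null set only. The factor
    \<open>indicator G\<close> is harmless when tested against \<open>f\<close>, because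
    \<open>G\<close> lies in \<open>F\<close> and contains \<open>E\<close>.\<close>
  define p where "p = (\<lambda>x. indicator G x * min 1 (max 0 (q x)))"
  have qM [measurable]: "q \<in> borel_measurable F" unfolding q_def by simp
  have pM: "p \<in> borel_measurable F" unfolding p_def using G by measurable
  have intE: "integrable M (indicator E :: 'a \<Rightarrow> real)" using E by (simp add: less_top[symmetric])
  have AE: "AE x in M. p x = indicator G x * q x"
  proof -
    have "AE x in M. q x \<ge> 0" unfolding q_def
      by (rule real_cond_exp_ge_c[OF intE]) (auto simp: indicator_def)
    moreover have "AE x in M. q x \<le> 1" unfolding q_def
      by (rule real_cond_exp_le_c[OF intE]) (auto simp: indicator_def)
    ultimately show ?thesis by eventually_elim (auto simp: p_def)
  qed
  have int: "expectation (\<lambda>x. p x * f x) = expectation (\<lambda>x. indicator E x * f x)"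
    if f: "f \<in> borel_measurable F" and b: "\<And>x. \<bar>f x\<bar> \<le> C" for f C
  proof -
    note [measurable] = f measurable_from_subalg[OF sub f] measurable_from_subalg[OF sub pM]
      measurable_from_subalg[OF sub qM] E G(1)
    have GM [measurable]: "G \<in> sets M" using sub G(1) unfolding subalgebra_def by auto
    have "expectation (\<lambda>x. p x * f x) = expectation (\<lambda>x. (indicator G x * f x) * q x)"
      by (rule integral_cong_AE) (use AE in auto)
    also have "\<dots> = expectation (\<lambda>x. (indicator G x * f x) * indicator E x)"
      unfolding q_def
    proof (rule real_cond_exp_intg)
      show "integrable M (\<lambda>x. indicator G x * f x * indicator E x)"
        by (rule integrable_bounded[where C = C]) (use b in \<open>auto simp: indicator_def abs_mult intro: order_trans[OF abs_ge_zero]\<close>)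
    qed measurable
    also have "\<dots> = expectation (\<lambda>x. indicator E x * f x)"
      using G(2) by (intro Bochner_Integration.integral_cong) (auto simp: indicator_def)
    finally show ?thesis .
  qed
  show ?thesis
    by (rule that[OF pM]) (use int in \<open>auto simp: p_def indicator_def\<close>)
qed

text \<open>The summands are martingale differences, hence orthogonal, and each has second moment at
  most the probability of its event. Disjointness of the events bounds the total by 1, whatever the
  number of cells.\<close>

lemma compensated_sum_L2:
  fixes F :: "nat \<Rightarrow> 'a measure" and p :: "nat \<Rightarrow> 'a \<Rightarrow> real"
  assumes sub: "\<And>j. subalgebra M (F j)" and mono: "\<And>j. subalgebra (F (Suc j)) (F j)"
    and E: "\<And>j. E j \<in> sets (F (Suc j))" and disj: "disjoint_family E"
    and p: "\<And>j. p j \<in> borel_measurable (F j)" "\<And>j x. 0 \<le> p j x" "\<And>j x. p j x \<le> 1"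
    and cond: "\<And>j f C. f \<in> borel_measurable (F j) \<Longrightarrow> (\<And>x. \<bar>f x\<bar> \<le> C) \<Longrightarrow>
       expectation (\<lambda>x. p j x * f x) = expectation (\<lambda>x. indicator (E j) x * f x)"
  shows "expectation (\<lambda>x. (\<Sum>j<n. indicator (E j) x - p j x)\<^sup>2) \<le> 1"
proof -
  define \<Psi> where "\<Psi> = (\<lambda>n x. \<Sum>j<n. indicator (E j) x - p j x)"
  have EM [measurable]: "E j \<in> sets M" for j
    using E[of j] sub[of "Suc j"] unfolding subalgebra_def by auto
  have pM [measurable]: "p j \<in> borel_measurable M" for j
    by (rule measurable_from_subalg[OF sub p(1)])
  have \<Psi>F: "\<Psi> n \<in> borel_measurable (F n)" for n
  proof (induction n)
    case (Suc n)
    have "\<Psi> n \<in> borel_measurable (F (Suc n))" "p n \<in> borel_measurable (F (Suc n))"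
      using measurable_from_subalg[OF mono] Suc p(1) by blast+
    then show ?case using E[of n] by (simp add: \<Psi>_def)
  qed (simp add: \<Psi>_def)
  note [measurable] = measurable_from_subalg[OF sub \<Psi>F]
  have xi: "\<bar>indicator (E j) x - p j x\<bar> \<le> 1" for j x
    using p(2)[of j x] p(3)[of j x] by (auto simp: indicator_def)
  have \<Psi>b: "\<bar>\<Psi> n x\<bar> \<le> real n" for n x
  proof -
    have "\<bar>\<Psi> n x\<bar> \<le> (\<Sum>j<n. \<bar>indicator (E j) x - p j x\<bar>)" unfolding \<Psi>_def by (rule sum_abs)
    also have "\<dots> \<le> (\<Sum>j<n. 1)" by (rule sum_mono) (rule xi)
    finally show ?thesis by simp
  qed
  have step: "expectation (\<lambda>x. (\<Psi> (Suc n) x)\<^sup>2) \<le> expectation (\<lambda>x. (\<Psi> n x)\<^sup>2) + prob (E n)" for n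
  proof -
    have pp: "p n x * \<bar>\<Psi> n x\<bar> \<le> real n" "p n x * p n x \<le> 1" for x
      using mult_mono[OF p(3)[of n x] \<Psi>b[of n x]] mult_mono[OF p(3)[of n x] p(3)[of n x]]
        p(2)[of n x] by auto
    have int: "integrable M (\<lambda>x. (\<Psi> n x)\<^sup>2)" "integrable M (\<lambda>x. p n x * \<Psi> n x)"
      "integrable M (\<lambda>x. indicator (E n) x * \<Psi> n x)" "integrable M (\<lambda>x. p n x * p n x)"
      "integrable M (\<lambda>x. indicator (E n) x * p n x)" "integrable M (indicator (E n) :: 'a \<Rightarrow> real)"
      subgoal by (rule integrable_bounded[where C = "(real n)\<^sup>2"])
          (auto intro!: order_trans[OF _ power_mono[OF \<Psi>b]])
      subgoal using pp by (intro integrable_bounded[where C = "real n"]) (auto simp: abs_mult p)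
      subgoal using \<Psi>b by (intro integrable_bounded[where C = "real n"]) (auto simp: abs_mult indicator_def)
      subgoal using pp by (intro integrable_bounded[where C = 1]) (auto simp: abs_mult p)
      subgoal using p by (intro integrable_bounded[where C = 1]) (auto simp: abs_mult indicator_def)
      subgoal by (intro integrable_bounded[where C = 1]) (auto simp: abs_mult indicator_def)
      done
    \<comment> \<open>By \<open>cond\<close>, the two cross terms with \<open>\<Psi> n\<close>
      cancel, and the remaining terms amount to \<open>prob (E n)\<close> minus the second moment of
      \<open>p n\<close>.\<close>
    have "(\<Psi> (Suc n) x)\<^sup>2 = (\<Psi> n x)\<^sup>2 + 2 * (indicator (E n) x * \<Psi> n x) - 2 * (p n x * \<Psi> n x)
        + indicator (E n) x - 2 * (indicator (E n) x * p n x) + p n x * p n x" for x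
      by (simp add: \<Psi>_def power2_eq_square algebra_simps indicator_def)
    then have "expectation (\<lambda>x. (\<Psi> (Suc n) x)\<^sup>2) = expectation (\<lambda>x. (\<Psi> n x)\<^sup>2)
        + 2 * expectation (\<lambda>x. indicator (E n) x * \<Psi> n x) - 2 * expectation (\<lambda>x. p n x * \<Psi> n x)
        + expectation (indicator (E n)) - 2 * expectation (\<lambda>x. indicator (E n) x * p n x)
        + expectation (\<lambda>x. p n x * p n x)"
      using int by simp
    moreover have "expectation (\<lambda>x. p n x * \<Psi> n x) = expectation (\<lambda>x. indicator (E n) x * \<Psi> n x)"
      by (rule cond[OF \<Psi>F \<Psi>b])
    moreover have "expectation (\<lambda>x. p n x * p n x) = expectation (\<lambda>x. indicator (E n) x * p n x)"
      using cond[of "p n" n 1] p by simp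
    moreover have "0 \<le> expectation (\<lambda>x. p n x * p n x)" by simp
    ultimately show ?thesis by simp
  qed
  have "expectation (\<lambda>x. (\<Psi> n x)\<^sup>2) \<le> (\<Sum>j<n. prob (E j))"
  proof (induction n)
    case (Suc n) then show ?case using step[of n] by simp
  qed (simp add: \<Psi>_def)
  also have "\<dots> = prob (\<Union>j<n. E j)"
    by (rule finite_measure_finite_Union[symmetric])
      (use disj in \<open>auto simp: disjoint_family_on_def\<close>)
  also have "\<dots> \<le> 1" by simp
  finally show ?thesis by (simp add: \<Psi>_def)
qed

text \<open>Cauchy-Schwarz in the form of Young's inequality with a free parameter \<open>r\<close>.
  Since \<open>f\<close> takes values in [0, 1], its square is at most \<open>f\<close>, so a small
  expectation of \<open>f\<close> suffices.\<close>

lemma weak_L2_bound: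
  fixes \<Psi> f :: "'a \<Rightarrow> real"
  assumes \<Psi>: "\<Psi> \<in> borel_measurable M" "\<And>x. \<bar>\<Psi> x\<bar> \<le> C" "expectation (\<lambda>x. (\<Psi> x)\<^sup>2) \<le> 1"
    and f: "f \<in> borel_measurable M" "\<And>x. 0 \<le> f x" "\<And>x. f x \<le> (1::real)" and r: "(r::real) > 0"
  shows "\<bar>expectation (\<lambda>x. \<Psi> x * f x)\<bar> \<le> r + expectation f / r"
proof -
  note [measurable] = \<Psi>(1) f(1)
  have C: "0 \<le> C" using \<Psi>(2) order_trans[OF abs_ge_zero] by blast
  have pt: "\<bar>\<Psi> x * f x\<bar> \<le> r * (\<Psi> x)\<^sup>2 + f x / r" for x
  proof -
    have "0 \<le> (r * \<bar>\<Psi> x\<bar> - f x)\<^sup>2" by simp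
    then have "2 * (r * (\<bar>\<Psi> x\<bar> * f x)) \<le> r\<^sup>2 * (\<Psi> x)\<^sup>2 + (f x)\<^sup>2"
      by (simp add: power2_eq_square algebra_simps)
    also have "(f x)\<^sup>2 \<le> f x" using f(2,3)[of x] by (simp add: power2_eq_square mult_left_le)
    finally have "2 * (r * (\<bar>\<Psi> x\<bar> * f x)) \<le> r\<^sup>2 * (\<Psi> x)\<^sup>2 + f x" by simp
    moreover have "0 \<le> r * (\<bar>\<Psi> x\<bar> * f x)" using r f(2) by simp
    ultimately have "r * (\<bar>\<Psi> x\<bar> * f x) \<le> r\<^sup>2 * (\<Psi> x)\<^sup>2 + f x" by linarith
    then have "\<bar>\<Psi> x\<bar> * f x \<le> (r\<^sup>2 * (\<Psi> x)\<^sup>2 + f x) / r" using r by (simp add: pos_le_divide_eq mult.commute)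
    also have "\<dots> = r * (\<Psi> x)\<^sup>2 + f x / r" using r by (simp add: field_simps power2_eq_square)
    finally show ?thesis using f(2)[of x] by (simp add: abs_mult)
  qed
  have sq: "(\<Psi> x)\<^sup>2 \<le> C\<^sup>2" for x using abs_le_square_iff[of "\<Psi> x" C] \<Psi>(2)[of x] C by simp
  have int: "integrable M (\<lambda>x. (\<Psi> x)\<^sup>2)" "integrable M f" "integrable M (\<lambda>x. \<Psi> x * f x)"
    subgoal by (rule integrable_bounded[where C = "C\<^sup>2"]) (use sq in auto)
    subgoal by (rule integrable_bounded[where C = 1]) (use f in auto)
    subgoal by (rule integrable_bounded[where C = "C * 1"])
        (use mult_mono[OF \<Psi>(2) f(3) C f(2)] f(2) in \<open>auto simp: abs_mult\<close>)
    done
  have "\<bar>expectation (\<lambda>x. \<Psi> x * f x)\<bar> \<le> expectation (\<lambda>x. \<bar>\<Psi> x * f x\<bar>)" by (rule integral_abs_bound)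
  also have "\<dots> \<le> expectation (\<lambda>x. r * (\<Psi> x)\<^sup>2 + f x / r)"
    by (rule integral_mono) (use int pt in auto)
  also have "\<dots> = r * expectation (\<lambda>x. (\<Psi> x)\<^sup>2) + expectation f / r" using int by simp
  also have "\<dots> \<le> r * 1 + expectation f / r" using r \<Psi>(3) by (intro add_right_mono mult_left_mono) auto
  finally show ?thesis by simp
qed

text \<open>The joint law of an \<open>F\<close>-measurable variable and of \<open>V\<close>,
  independent of \<open>F\<close>, is a product measure, so Fubini integrates \<open>V\<close> out
  first. Independence is assumed as a product rule for events because
  \<open>indep_past_future\<close> delivers it in this form.\<close>

lemma expectation_freeze:
  fixes \<phi> :: "'u \<times> 'v \<Rightarrow> real"
  assumes sub: "subalgebra M F" and V: "V \<in> measurable M N"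
    and indep: "\<And>A B. A \<in> sets F \<Longrightarrow> B \<in> sets N \<Longrightarrow>
      prob (A \<inter> (V -` B \<inter> space M)) = prob A * prob (V -` B \<inter> space M)"
    and U: "U \<in> measurable F L" and g: "g \<in> borel_measurable F"
    and \<phi>: "\<phi> \<in> borel_measurable (L \<Otimes>\<^sub>M N)"
    and int: "integrable M (\<lambda>x. g x * \<phi> (U x, V x))"
  shows "expectation (\<lambda>x. g x * \<phi> (U x, V x)) =
    expectation (\<lambda>x. g x * expectation (\<lambda>y. \<phi> (U x, V y)))"
proof -
  \<comment> \<open>The weight \<open>g\<close> is carried along with \<open>U\<close> in one
    \<open>F\<close>-measurable variable, so that a single product measure is enough.\<close>
  define U' where "U' = (\<lambda>x. (g x, U x))"
  define \<phi>' where "\<phi>' = (\<lambda>(z, v). fst z * \<phi> (snd z, v))"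
  have U'F: "U' \<in> measurable F (borel \<Otimes>\<^sub>M L)" unfolding U'_def using g U by measurable
  have U'M: "U' \<in> measurable M (borel \<Otimes>\<^sub>M L)" by (rule measurable_from_subalg[OF sub U'F])
  note [measurable] = V U'M \<phi> measurable_from_subalg[OF sub g] measurable_from_subalg[OF sub U]
  have \<phi>'M [measurable]: "\<phi>' \<in> borel_measurable ((borel \<Otimes>\<^sub>M L) \<Otimes>\<^sub>M N)"
    unfolding \<phi>'_def by measurable
  interpret D1: prob_space "distr M (borel \<Otimes>\<^sub>M L) U'" by (rule prob_space_distr) simp
  interpret D2: prob_space "distr M N V" by (rule prob_space_distr) simp
  interpret D: pair_sigma_finite "distr M (borel \<Otimes>\<^sub>M L) U'" "distr M N V" ..
  have eq: "distr M (borel \<Otimes>\<^sub>M L) U' \<Otimes>\<^sub>M distr M N V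
      = distr M ((borel \<Otimes>\<^sub>M L) \<Otimes>\<^sub>M N) (\<lambda>x. (U' x, V x))"
  proof (rule pair_measure_eqI)
    fix A B assume "A \<in> sets (distr M (borel \<Otimes>\<^sub>M L) U')" "B \<in> sets (distr M N V)"
    then have [measurable]: "A \<in> sets (borel \<Otimes>\<^sub>M L)" "B \<in> sets N" by simp_all
    have "U' -` A \<inter> space M \<in> sets F"
      using measurable_sets[OF U'F, of A] sub by (simp add: subalgebra_def)
    have indep_aux: "(U' -` A \<inter> space M) \<inter> (V -` B \<inter> space M) =
        (\<lambda>x. (U' x, V x)) -` (A \<times> B) \<inter> space M"
      by auto
    from indep[OF \<open>U' -` A \<inter> space M \<in> sets F\<close> \<open>B \<in> sets N\<close>]
    have "prob ((\<lambda>x. (U' x, V x)) -` (A \<times> B) \<inter> space M) =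
        prob (U' -` A \<inter> space M) * prob (V -` B \<inter> space M)"
      by (subst (asm) indep_aux) simp
    then show "emeasure (distr M (borel \<Otimes>\<^sub>M L) U') A * emeasure (distr M N V) B =
        emeasure (distr M ((borel \<Otimes>\<^sub>M L) \<Otimes>\<^sub>M N) (\<lambda>x. (U' x, V x))) (A \<times> B)"
      by (simp add: emeasure_distr emeasure_eq_measure ennreal_mult)
  qed (auto intro: D1.sigma_finite_measure_axioms D2.sigma_finite_measure_axioms)
  have "integrable (distr M ((borel \<Otimes>\<^sub>M L) \<Otimes>\<^sub>M N) (\<lambda>x. (U' x, V x))) \<phi>'"
    by (subst integrable_distr_eq) (use int in \<open>auto simp: \<phi>'_def U'_def\<close>)
  then have "integrable (distr M (borel \<Otimes>\<^sub>M L) U' \<Otimes>\<^sub>M distr M N V) \<phi>'" unfolding eq .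
  from D.integral_fst'[OF this]
  have "(\<integral>z. (\<integral>v. \<phi>' (z, v) \<partial>distr M N V) \<partial>distr M (borel \<Otimes>\<^sub>M L) U') =
      (\<integral>q. \<phi>' q \<partial>distr M ((borel \<Otimes>\<^sub>M L) \<Otimes>\<^sub>M N) (\<lambda>x. (U' x, V x)))"
    unfolding eq .
  also have "\<dots> = expectation (\<lambda>x. g x * \<phi> (U x, V x))"
    by (subst integral_distr) (auto simp: \<phi>'_def U'_def)
  also have "(\<integral>z. (\<integral>v. \<phi>' (z, v) \<partial>distr M N V) \<partial>distr M (borel \<Otimes>\<^sub>M L) U') =
      expectation (\<lambda>x. \<integral>v. \<phi>' (U' x, v) \<partial>distr M N V)"
    by (rule integral_distr) (auto intro!: D2.borel_measurable_lebesgue_integral)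
  also have "\<dots> = expectation (\<lambda>x. expectation (\<lambda>y. \<phi>' (U' x, V y)))"
    using measurable_space[OF U'M]
    by (intro Bochner_Integration.integral_cong refl integral_distr) auto
  also have "\<dots> = expectation (\<lambda>x. g x * expectation (\<lambda>y. \<phi> (U x, V y)))"
    by (simp add: \<phi>'_def U'_def)
  finally show ?thesis by simp
qed

end

section \<open>Path space and shift invariance\<close>

lemma space_path_space: "space path_space = Omega0"
  by (simp add: path_space_def space_restrict_space space_PiM)

lemma measurable_path_coordinate: "(\<lambda>\<omega>. \<omega> t) \<in> borel_measurable path_space"
  unfolding path_space_def
  by (rule measurable_restrict_space1) (rule measurable_component_singleton, simp)

lemma measurable_path_spaceI:
  assumes "f \<in> space N \<rightarrow> Omega0" "\<And>t. (\<lambda>x. f x t) \<in> borel_measurable N"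
  shows "f \<in> measurable N path_space"
  unfolding path_space_def using assms
  by (intro measurable_restrict_space2 measurable_PiM_single') (auto simp: space_PiM)

lemma levy_shift_in_Omega0:
  assumes "\<omega> \<in> Omega0"
  shows "levy_shift h \<omega> \<in> Omega0"
proof -
  have "continuous_on UNIV (\<lambda>t. \<omega> (h + t))"
    by (rule continuous_on_compose2[of UNIV \<omega>]) (use assms in \<open>auto simp: Omega0_def intro!: continuous_intros\<close>)
  then show ?thesis by (auto simp: Omega0_def levy_shift_def intro!: continuous_intros)
qed

lemma measurable_levy_shift: "levy_shift h \<in> measurable path_space path_space"
proof (rule measurable_path_spaceI)
  note [measurable] = measurable_path_coordinate
  show "(\<lambda>\<omega>. levy_shift h \<omega> t) \<in> borel_measurable path_space" for t
    unfolding levy_shift_def by measurable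
qed (use levy_shift_in_Omega0 in \<open>auto simp: space_path_space\<close>)

text \<open>Increments from a base point \<open>w\<close>, not path values, because the increment
  fields see only increments: with \<open>w\<close> at the left end of a window, the part of such an
  event before a later time is decided by the past. Finite sets of constraints are closed under
  union, which gives a pi-system. The strict inequality lets the indicator be approximated from
  below by Lipschitz functions.\<close>

definition path_cylinder :: "real \<Rightarrow> (real \<times> real) set \<Rightarrow> (real \<Rightarrow> real) set" where
  "path_cylinder w K = {\<omega> \<in> Omega0. \<forall>(t, c)\<in>K. \<omega> t - \<omega> w < c}"

lemma Int_stable_path_cylinder: "Int_stable {path_cylinder w K | K. finite K}"
proof (rule Int_stableI)
  fix a b assume "a \<in> {path_cylinder w K | K. finite K}" "b \<in> {path_cylinder w K | K. finite K}"
  then obtain K L where "a = path_cylinder w K" "finite K" "b = path_cylinder w L" "finite L" by auto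
  then have "a \<inter> b = path_cylinder w (K \<union> L)" "finite (K \<union> L)" by (auto simp: path_cylinder_def)
  then show "a \<inter> b \<in> {path_cylinder w K | K. finite K}" by blast
qed

lemma path_cylinder_sets:
  assumes "finite K"
  shows "path_cylinder w K \<in> sets path_space"
proof -
  note [measurable] = measurable_path_coordinate
  have "path_cylinder w K = {\<omega> \<in> space path_space. \<forall>k\<in>K. \<omega> (fst k) - \<omega> w < snd k}"
    by (auto simp: path_cylinder_def space_path_space)
  also have "\<dots> \<in> sets path_space" using assms by measurable
  finally show ?thesis .
qed

text \<open>Any base point works: paths vanish at 0, so \<open>\<omega> t\<close> is the difference
  of the increments from \<open>w\<close> to \<open>t\<close> and from \<open>w\<close> to
  0.\<close>

lemma sets_path_space:
  "sets path_space = sigma_sets Omega0 {path_cylinder w K | K. finite K}" (is "_ = sigma_sets _ ?G")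
proof
  show "sigma_sets Omega0 ?G \<subseteq> sets path_space"
    unfolding space_path_space[symmetric]
    by (rule sets.sigma_sets_subset) (auto simp: path_cylinder_sets)
  define N where "N = sigma Omega0 ?G"
  have G: "?G \<subseteq> Pow Omega0" by (auto simp: path_cylinder_def)
  have N: "space N = Omega0" "sets N = sigma_sets Omega0 ?G"
    using G by (auto simp: N_def space_measure_of sets_measure_of)
  have incr [measurable]: "(\<lambda>\<omega>. \<omega> t - \<omega> w) \<in> borel_measurable N" for t
    unfolding borel_measurable_iff_less
  proof
    fix c
    have "{\<omega> \<in> space N. \<omega> t - \<omega> w < c} = path_cylinder w {(t, c)}"
      by (auto simp: N path_cylinder_def)
    then show "{\<omega> \<in> space N. \<omega> t - \<omega> w < c} \<in> sets N" unfolding N(2) by (auto intro!: sigma_sets.Basic)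
  qed
  have "(\<lambda>\<omega>. (\<omega> t - \<omega> w) - (\<omega> 0 - \<omega> w)) \<in> borel_measurable N" for t by measurable
  then have "(\<lambda>\<omega>. \<omega> t) \<in> borel_measurable N" for t
    by (subst measurable_cong[where g = "\<lambda>\<omega>. (\<omega> t - \<omega> w) - (\<omega> 0 - \<omega> w)"]) (auto simp: N Omega0_def)
  then have "(\<lambda>\<omega>. \<omega>) \<in> measurable N path_space"
    by (intro measurable_path_spaceI) (auto simp: N)
  show "sets path_space \<subseteq> sigma_sets Omega0 ?G"
  proof
    fix A assume A: "A \<in> sets path_space"
    then have "A \<subseteq> Omega0" using sets.sets_into_space space_path_space by blast
    with measurable_sets[OF \<open>(\<lambda>\<omega>. \<omega>) \<in> measurable N path_space\<close> A] show "A \<in> sigma_sets Omega0 ?G"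
      by (simp add: N Int_absorb2 vimage_def)
  qed
qed

section \<open>Gaussian increments and invariance of the Wiener measure under the Levy shift\<close>

locale two_sided_wiener =
  fixes P :: "(real \<Rightarrow> real) measure"
  assumes prob_space_P: "prob_space P" and sets_P: "sets P = sets path_space"
    and forward: "standard_brownian_motion P (\<lambda>t \<omega>. \<omega> t)"
    and backward: "standard_brownian_motion P (\<lambda>t \<omega>. \<omega> (- t))"
    and indep_sides: "prob_space.indep_var P
      (\<Pi>\<^sub>M t\<in>{0..}. borel) (\<lambda>\<omega>. \<lambda>t\<in>{0..}. \<omega> t)
      (\<Pi>\<^sub>M t\<in>{0..}. borel) (\<lambda>\<omega>. \<lambda>t\<in>{0..}. \<omega> (- t))"
begin

sublocale P: prob_space P by (fact prob_space_P)

lemma space_P: "space P = Omega0"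
  using sets_eq_imp_space_eq[OF sets_P] space_path_space by simp

lemma coordinate_measurable_P [measurable]: "(\<lambda>\<omega>. \<omega> t) \<in> borel_measurable P"
  using measurable_path_coordinate measurable_cong_sets[OF sets_P refl] by blast

lemma levy_shift_measurable_P [measurable]: "levy_shift h \<in> measurable P P"
  using measurable_levy_shift measurable_cong_sets[OF sets_P sets_P] by blast

text \<open>Times on one side of 0 are read off from one of the two Brownian motions. Intervals
  across 0 are reached only through shift invariance, in
  \<open>increment_distributed\<close>.\<close>

lemma increment_distributed_side:
  assumes "s < t" "0 \<le> s \<or> t \<le> 0"
  shows "distributed P lborel (\<lambda>\<omega>. \<omega> t - \<omega> s) (normal_density 0 (sqrt (t - s)))"
  using assms(2)
proof
  assume "0 \<le> s"
  then show ?thesis using forward assms(1) unfolding standard_brownian_motion_def by blast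
next
  assume "t \<le> 0"
  have "\<forall>s t. 0 \<le> s \<longrightarrow> s < t \<longrightarrow>
      distributed P lborel (\<lambda>\<omega>. \<omega> (- t) - \<omega> (- s)) (normal_density 0 (sqrt (t - s)))"
    using backward unfolding standard_brownian_motion_def by blast
  from this[rule_format, of "- t" "- s"] \<open>t \<le> 0\<close> have "distributed P lborel (\<lambda>\<omega>. \<omega> s - \<omega> t) (normal_density 0 (sqrt (t - s)))"
    using assms(1) by simp
  from P.normal_density_affine[OF this, of "-1" 0] show ?thesis using assms(1) by simp
qed

text \<open>The grid passes through 0 at index \<open>m\<close>. Increments after 0 are independent
  by the forward motion, those before 0 by the backward motion, and the two groups by
  \<open>indep_sides\<close>. The resulting law depends on the spacings only, not on where 0 sits,
  which is the source of shift invariance.\<close>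

lemma grid_law:
  fixes r :: "nat \<Rightarrow> real"
  assumes r: "strict_mono_on {..n} r" and m: "m \<le> n" "r m = 0"
    and \<delta>: "\<And>i. \<delta> i > 0" "\<And>i. i < n \<Longrightarrow> \<delta> i = r (Suc i) - r i"
  shows "distr P (\<Pi>\<^sub>M i\<in>{..<n}. borel) (\<lambda>\<omega>. \<lambda>i\<in>{..<n}. \<omega> (r (Suc i)) - \<omega> (r i))
    = (\<Pi>\<^sub>M i\<in>{..<n}. density lborel (normal_density 0 (sqrt (\<delta> i))))"
proof -
  have less: "r i < r j" if "i < j" "j \<le> n" for i j
    using r that by (auto simp: strict_mono_on_def)
  have le: "r i \<le> r j" if "i \<le> j" "j \<le> n" for i j
    using less[of i j] that by (cases "i = j") auto
  define D where "D = (\<lambda>i. density lborel (normal_density 0 (sqrt (\<delta> i))))"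
  interpret product_sigma_finite D
    unfolding product_sigma_finite_def D_def
    using prob_space_normal_density prob_space_imp_sigma_finite \<delta>(1) real_sqrt_gt_zero by blast
  show ?thesis unfolding D_def[symmetric]
  proof (rule PiM_eqI)
    show "sets (distr P (\<Pi>\<^sub>M i\<in>{..<n}. borel) (\<lambda>\<omega>. \<lambda>i\<in>{..<n}. \<omega> (r (Suc i)) - \<omega> (r i))) = sets (PiM {..<n} D)"
      by (simp, rule sets_PiM_cong) (auto simp: D_def)
    fix A assume "\<And>i. i \<in> {..<n} \<Longrightarrow> A i \<in> sets (D i)"
    then have A [measurable]: "i < n \<Longrightarrow> A i \<in> sets borel" for i by (simp add: D_def)
    define p where "p = (\<lambda>i. P.prob {\<omega> \<in> space P. \<omega> (r (Suc i)) - \<omega> (r i) \<in> A i})"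
    \<comment> \<open>\<open>R\<close> and \<open>L\<close> express the constraints right and left
      of 0 as events for the two half-paths whose independence is assumed.\<close>
    define R where "R = {f \<in> space (\<Pi>\<^sub>M t\<in>{0::real..}. borel :: real measure). \<forall>i\<in>{m..<n}. f (r (Suc i)) - f (r i) \<in> A i}"
    define L where "L = {f \<in> space (\<Pi>\<^sub>M t\<in>{0::real..}. borel :: real measure). \<forall>i\<in>{..<m}. f (- r (Suc i)) - f (- r i) \<in> A i}"
    have pos: "0 \<le> r i" if "m \<le> i" "i \<le> n" for i using le[of m i] that m by simp
    have neg: "r i \<le> 0" if "i \<le> m" for i using le[of i m] that m by simp
    have "R \<in> sets (\<Pi>\<^sub>M t\<in>{0..}. borel)"
      unfolding R_def
    proof (rule sets.sets_Collect_finite_All)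
      fix i assume "i \<in> {m..<n}"
      then have [measurable]: "A i \<in> sets borel" "r i \<in> {0..}" "r (Suc i) \<in> {0..}"
        using pos[of i] pos[of "Suc i"] by auto
      show "{f \<in> space (\<Pi>\<^sub>M t\<in>{0::real..}. borel :: real measure). f (r (Suc i)) - f (r i) \<in> A i} \<in> sets (\<Pi>\<^sub>M t\<in>{0..}. borel)"
        by measurable
    qed simp
    moreover have "L \<in> sets (\<Pi>\<^sub>M t\<in>{0..}. borel)"
      unfolding L_def
    proof (rule sets.sets_Collect_finite_All)
      fix i assume "i \<in> {..<m}"
      then have [measurable]: "A i \<in> sets borel" "- r i \<in> {0..}" "- r (Suc i) \<in> {0..}"
        using neg[of i] neg[of "Suc i"] m by auto
      show "{f \<in> space (\<Pi>\<^sub>M t\<in>{0::real..}. borel :: real measure). f (- r (Suc i)) - f (- r i) \<in> A i} \<in> sets (\<Pi>\<^sub>M t\<in>{0..}. borel)"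
        by measurable
    qed simp
    ultimately have "P.prob ((\<lambda>\<omega>. (\<lambda>t\<in>{0..}. \<omega> t, \<lambda>t\<in>{0..}. \<omega> (- t))) -` (R \<times> L) \<inter> space P)
      = P.prob ((\<lambda>\<omega>. \<lambda>t\<in>{0..}. \<omega> t) -` R \<inter> space P) * P.prob ((\<lambda>\<omega>. \<lambda>t\<in>{0..}. \<omega> (- t)) -` L \<inter> space P)"
      by (rule P.indep_varD[OF indep_sides])
    also have "(\<lambda>\<omega>. \<lambda>t\<in>{0..}. \<omega> t) -` R \<inter> space P = {\<omega> \<in> space P. \<forall>i\<in>{m..<n}. \<omega> (r (Suc i)) - \<omega> (r i) \<in> A i}"
      using pos by (auto simp: R_def space_PiM)
    also have "(\<lambda>\<omega>. \<lambda>t\<in>{0..}. \<omega> (- t)) -` L \<inter> space P = {\<omega> \<in> space P. \<forall>i\<in>{..<m}. \<omega> (r (Suc i)) - \<omega> (r i) \<in> A i}"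
      using neg by (auto simp: L_def space_PiM)
    also have "(\<lambda>\<omega>. (\<lambda>t\<in>{0..}. \<omega> t, \<lambda>t\<in>{0..}. \<omega> (- t))) -` (R \<times> L) \<inter> space P
        = ((\<lambda>\<omega>. \<lambda>t\<in>{0..}. \<omega> t) -` R \<inter> space P) \<inter> ((\<lambda>\<omega>. \<lambda>t\<in>{0..}. \<omega> (- t)) -` L \<inter> space P)" by auto
    also have "\<dots> = {\<omega> \<in> space P. \<forall>i\<in>{m..<n}. \<omega> (r (Suc i)) - \<omega> (r i) \<in> A i}
        \<inter> {\<omega> \<in> space P. \<forall>i\<in>{..<m}. \<omega> (r (Suc i)) - \<omega> (r i) \<in> A i}"
      using pos neg by (auto simp: R_def L_def space_PiM)
    also have "\<dots> = {\<omega> \<in> space P. \<forall>i<n. \<omega> (r (Suc i)) - \<omega> (r i) \<in> A i}"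
      using m(1) by (auto simp: not_le)
    finally have split: "P.prob {\<omega> \<in> space P. \<forall>i<n. \<omega> (r (Suc i)) - \<omega> (r i) \<in> A i} =
        P.prob {\<omega> \<in> space P. \<forall>i\<in>{m..<n}. \<omega> (r (Suc i)) - \<omega> (r i) \<in> A i} *
        P.prob {\<omega> \<in> space P. \<forall>i\<in>{..<m}. \<omega> (r (Suc i)) - \<omega> (r i) \<in> A i}" .
    have R: "P.prob {\<omega> \<in> space P. \<forall>i\<in>{m..<n}. \<omega> (r (Suc i)) - \<omega> (r i) \<in> A i} = (\<Prod>i\<in>{m..<n}. p i)"
    proof (cases "m = n")
      case False
      define s where "s = (\<lambda>k. r (k + m))"
      have "strict_mono_on {..n - m} s" using less by (auto simp: s_def strict_mono_on_def)
      moreover have "0 \<le> s 0" using m by (simp add: s_def)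
      ultimately have ind: "P.indep_vars (\<lambda>_. borel) (\<lambda>i \<omega>. \<omega> (s (Suc i)) - \<omega> (s i)) {..<n - m}"
        using forward unfolding standard_brownian_motion_def by blast
      have "P.prob (\<Inter>k\<in>{..<n - m}. (\<lambda>\<omega>. \<omega> (s (Suc k)) - \<omega> (s k)) -` A (k + m) \<inter> space P)
          = (\<Prod>k\<in>{..<n - m}. P.prob ((\<lambda>\<omega>. \<omega> (s (Suc k)) - \<omega> (s k)) -` A (k + m) \<inter> space P))"
        by (rule P.indep_varsD[OF ind]) (use False m in \<open>auto intro!: A simp: lessThan_empty_iff\<close>)
      also have "\<dots> = (\<Prod>k\<in>{..<n - m}. p (k + m))"
        by (intro prod.cong refl) (auto simp: p_def s_def intro!: arg_cong[where f = P.prob])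
      also have "\<dots> = (\<Prod>i\<in>{m..<n}. p i)"
        by (rule prod.reindex_bij_witness[of _ "\<lambda>i. i - m" "\<lambda>k. k + m"]) auto
      also have "(\<Inter>k\<in>{..<n - m}. (\<lambda>\<omega>. \<omega> (s (Suc k)) - \<omega> (s k)) -` A (k + m) \<inter> space P)
          = {\<omega> \<in> space P. \<forall>i\<in>{m..<n}. \<omega> (r (Suc i)) - \<omega> (r i) \<in> A i}"
      proof -
        have "(\<forall>k<n - m. Q (k + m)) \<longleftrightarrow> (\<forall>i\<in>{m..<n}. Q i)" for Q
        proof (intro iffI ballI)
          fix i assume "\<forall>k<n - m. Q (k + m)" "i \<in> {m..<n}"
          then show "Q i" by (auto dest: spec[of _ "i - m"])
        qed auto
        then have "(\<forall>k<n - m. \<omega> (s (Suc k)) - \<omega> (s k) \<in> A (k + m)) \<longleftrightarrow>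
            (\<forall>i\<in>{m..<n}. \<omega> (r (Suc i)) - \<omega> (r i) \<in> A i)" for \<omega>
          unfolding s_def add_Suc .
        moreover have "n - m \<noteq> 0" using False m by simp
        ultimately show ?thesis by (auto simp: lessThan_empty_iff)
      qed
      finally show ?thesis .
    qed (simp add: P.prob_space)
    have L: "P.prob {\<omega> \<in> space P. \<forall>i\<in>{..<m}. \<omega> (r (Suc i)) - \<omega> (r i) \<in> A i} = (\<Prod>i\<in>{..<m}. p i)"
    proof (cases "m = 0")
      case False
      \<comment> \<open>Reflection reverses the order of the grid points left of 0. The
        \<open>k\<close>-th increment of the backward motion is minus the grid increment with index
        \<open>m - Suc k\<close>, hence the reflected sets below.\<close>
      define s where "s = (\<lambda>k. - r (m - k))"
      have "strict_mono_on {..m} s" using less m by (auto simp: s_def strict_mono_on_def)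
      moreover have "0 \<le> s 0" using m by (simp add: s_def)
      ultimately have ind: "P.indep_vars (\<lambda>_. borel) (\<lambda>i \<omega>. \<omega> (- s (Suc i)) - \<omega> (- s i)) {..<m}"
        using backward unfolding standard_brownian_motion_def by blast
      have "P.prob (\<Inter>k\<in>{..<m}. (\<lambda>\<omega>. \<omega> (- s (Suc k)) - \<omega> (- s k)) -` (uminus -` A (m - Suc k)) \<inter> space P)
          = (\<Prod>k\<in>{..<m}. P.prob ((\<lambda>\<omega>. \<omega> (- s (Suc k)) - \<omega> (- s k)) -` (uminus -` A (m - Suc k)) \<inter> space P))"
      proof (rule P.indep_varsD[OF ind])
        fix k assume "k \<in> {..<m}"
        then have [measurable]: "A (m - Suc k) \<in> sets borel" using m by (intro A) auto
        show "uminus -` A (m - Suc k) \<in> sets (borel :: real measure)"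
          using measurable_sets[of uminus "borel :: real measure" borel "A (m - Suc k)"] by simp
      qed (use False in \<open>auto simp: lessThan_empty_iff\<close>)
      also have "\<dots> = (\<Prod>k\<in>{..<m}. p (m - Suc k))"
        by (intro prod.cong refl) (auto simp: p_def s_def Suc_diff_Suc intro!: arg_cong[where f = P.prob])
      also have "\<dots> = (\<Prod>i\<in>{..<m}. p i)"
        by (rule prod.reindex_bij_witness[of _ "\<lambda>i. m - Suc i" "\<lambda>i. m - Suc i"]) auto
      also have "(\<Inter>k\<in>{..<m}. (\<lambda>\<omega>. \<omega> (- s (Suc k)) - \<omega> (- s k)) -` (uminus -` A (m - Suc k)) \<inter> space P)
          = {\<omega> \<in> space P. \<forall>i\<in>{..<m}. \<omega> (r (Suc i)) - \<omega> (r i) \<in> A i}"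
      proof -
        have "(\<forall>k<m. Q (m - Suc k)) \<longleftrightarrow> (\<forall>i<m. Q i)" for Q
        proof (intro iffI allI impI)
          fix i assume "\<forall>k<m. Q (m - Suc k)" "i < m"
          then show "Q i" by (auto dest: spec[of _ "m - Suc i"])
        qed auto
        then have *: "(\<forall>k<m. \<omega> (r (Suc (m - Suc k))) - \<omega> (r (m - Suc k)) \<in> A (m - Suc k)) \<longleftrightarrow>
            (\<forall>i<m. \<omega> (r (Suc i)) - \<omega> (r i) \<in> A i)" for \<omega> .
        have "(\<Inter>k\<in>{..<m}. (\<lambda>\<omega>. \<omega> (- s (Suc k)) - \<omega> (- s k)) -` (uminus -` A (m - Suc k)) \<inter> space P)
          = {\<omega> \<in> space P. \<forall>k<m. \<omega> (r (Suc (m - Suc k))) - \<omega> (r (m - Suc k)) \<in> A (m - Suc k)}"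
          using False by (auto simp: s_def Suc_diff_Suc lessThan_empty_iff)
        then show ?thesis unfolding * by (simp only: Ball_def lessThan_iff)
      qed
      finally show ?thesis .
    qed (simp add: P.prob_space)
    have "emeasure (distr P (\<Pi>\<^sub>M i\<in>{..<n}. borel) (\<lambda>\<omega>. \<lambda>i\<in>{..<n}. \<omega> (r (Suc i)) - \<omega> (r i))) (Pi\<^sub>E {..<n} A)
        = emeasure P ((\<lambda>\<omega>. \<lambda>i\<in>{..<n}. \<omega> (r (Suc i)) - \<omega> (r i)) -` (Pi\<^sub>E {..<n} A) \<inter> space P)"
    proof (rule emeasure_distr)
      show "(\<lambda>\<omega>. \<lambda>i\<in>{..<n}. \<omega> (r (Suc i)) - \<omega> (r i)) \<in> measurable P (\<Pi>\<^sub>M i\<in>{..<n}. borel)"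
        by measurable
      show "Pi\<^sub>E {..<n} A \<in> sets (\<Pi>\<^sub>M i\<in>{..<n}. borel)"
        by (rule sets_PiM_I_finite) (simp_all add: A)
    qed
    also have "(\<lambda>\<omega>. \<lambda>i\<in>{..<n}. \<omega> (r (Suc i)) - \<omega> (r i)) -` (Pi\<^sub>E {..<n} A) \<inter> space P
        = {\<omega> \<in> space P. \<forall>i<n. \<omega> (r (Suc i)) - \<omega> (r i) \<in> A i}"
      by (rule set_eqI) (simp add: Pi_iff Ball_def conj_commute)
    also have "emeasure P \<dots> = ennreal ((\<Prod>i\<in>{..<m}. p i) * (\<Prod>i\<in>{m..<n}. p i))"
      by (simp only: P.emeasure_eq_measure split L R mult.commute)
    also have "(\<Prod>i\<in>{..<m}. p i) * (\<Prod>i\<in>{m..<n}. p i) = (\<Prod>i<n. p i)"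
      unfolding lessThan_atLeast0 using m(1) by (intro prod.atLeastLessThan_concat) auto
    also have "ennreal (\<Prod>i<n. p i) = (\<Prod>i<n. ennreal (p i))"
      by (rule prod_ennreal[symmetric]) (simp add: p_def)
    also have "\<dots> = (\<Prod>i<n. emeasure (D i) (A i))"
    proof (rule prod.cong[OF refl])
      fix i assume i: "i \<in> {..<n}"
      then have ri: "r i < r (Suc i)" using less[of i "Suc i"] by simp
      have "0 \<le> r i \<or> r (Suc i) \<le> 0"
      proof (cases "m \<le> i")
        case True
        then show ?thesis using pos[of i] i by simp
      next
        case False
        then show ?thesis using neg[of "Suc i"] by simp
      qed
      from distributed_distr_eq_density[OF increment_distributed_side[OF ri this]]
      have "D i = distr P lborel (\<lambda>\<omega>. \<omega> (r (Suc i)) - \<omega> (r i))" using \<delta>(2)[of i] i by (simp add: D_def)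
      then show "ennreal (p i) = emeasure (D i) (A i)"
        using A[of i] i by (simp add: emeasure_distr p_def P.emeasure_eq_measure vimage_def Int_def conj_commute)
    qed
    finally show "emeasure (distr P (\<Pi>\<^sub>M i\<in>{..<n}. borel) (\<lambda>\<omega>. \<lambda>i\<in>{..<n}. \<omega> (r (Suc i)) - \<omega> (r i))) (Pi\<^sub>E {..<n} A)
        = (\<Prod>i\<in>{..<n}. emeasure (D i) (A i))" .
  qed simp
qed

text \<open>It suffices to compare cylinder events based at 0. For the path and for its shift, such
  an event is the same condition on the increments over a grid and over its translate by
  \<open>h\<close>, and \<open>grid_law\<close> gives these the same law.\<close>

lemma distr_levy_shift: "distr P P (levy_shift h) = P"
proof (rule measure_eqI_generator_eq[where E = "{path_cylinder 0 K | K. finite K}" and \<Omega> = Omega0 and A = "\<lambda>_. Omega0"])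
  fix X assume "X \<in> {path_cylinder 0 K | K. finite K}"
  then obtain K where X: "X = path_cylinder 0 K" and K: "finite K" by auto
  \<comment> \<open>The points 0 and \<open>- h\<close> are added so that both the grid and its
    translate by \<open>h\<close> contain the time 0, as \<open>grid_law\<close> demands.\<close>
  define T where "T = fst ` K \<union> {0, - h}"
  have T: "finite T" "T \<noteq> {}" using K by (auto simp: T_def)
  define n where "n = card T - 1"
  define r where "r = (\<lambda>i. sorted_list_of_set T ! i)"
  have len: "length (sorted_list_of_set T) = Suc n"
    using T card_gt_0_iff[of T] by (simp add: n_def)
  have r: "strict_mono_on {..n} r"
    unfolding strict_mono_on_def r_def
    using sorted_wrt_nth_less[OF strict_sorted_list_of_set[of T]] len by auto
  have "\<exists>i\<le>n. r i = t" if "t \<in> T" for t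
    using that T len in_set_conv_nth[of t "sorted_list_of_set T"] by (auto simp: r_def less_Suc_eq_le)
  then obtain \<iota> where \<iota>: "\<And>t. t \<in> T \<Longrightarrow> \<iota> t \<le> n" "\<And>t. t \<in> T \<Longrightarrow> r (\<iota> t) = t" by metis
  \<comment> \<open>The value 1 beyond the grid is an arbitrary positive default that keeps every
    factor of the product a probability measure.\<close>
  define \<delta> where "\<delta> = (\<lambda>i. if i < n then r (Suc i) - r i else 1)"
  have \<delta>: "\<delta> i > 0" for i using r by (auto simp: \<delta>_def strict_mono_on_def)
  \<comment> \<open>Partial sums telescope to increments from the first grid point. Subtracting the
    sum up to the index of 0 moves the base point to 0.\<close>
  define C where "C = {x \<in> space (\<Pi>\<^sub>M i\<in>{..<n}. borel :: real measure).
    \<forall>k\<in>K. (\<Sum>i<\<iota> (fst k). x i) - (\<Sum>i<\<iota> 0. x i) < snd k}"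
  have zT: "0 \<in> T" "- h \<in> T" and KT: "k \<in> K \<Longrightarrow> fst k \<in> T" for k by (auto simp: T_def)
  have C: "C \<in> sets (\<Pi>\<^sub>M i\<in>{..<n}. borel)"
  proof -
    have [measurable]: "(\<lambda>x. \<Sum>i<\<iota> t. x i) \<in> borel_measurable (\<Pi>\<^sub>M i\<in>{..<n}. borel :: real measure)" if "t \<in> T" for t
      using \<iota>(1)[OF that] by (intro borel_measurable_sum measurable_component_singleton) auto
    show ?thesis unfolding C_def using K zT KT by measurable
  qed
  have tele: "(\<Sum>i<\<iota> t. (\<lambda>i\<in>{..<n}. f (Suc i) - f i) i) = f (\<iota> t) - f 0" if "t \<in> T" for t and f :: "nat \<Rightarrow> real"
  proof -
    have "(\<Sum>i<\<iota> t. (\<lambda>i\<in>{..<n}. f (Suc i) - f i) i) = (\<Sum>i<\<iota> t. f (Suc i) - f i)"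
      using \<iota>(1)[OF that] by (intro sum.cong) auto
    then show ?thesis by (simp add: sum_lessThan_telescope)
  qed
  have pre: "(\<lambda>\<omega>. \<lambda>i\<in>{..<n}. \<omega> (r (Suc i) + u) - \<omega> (r i + u)) -` C \<inter> space P
      = {\<omega> \<in> Omega0. \<forall>(t, c)\<in>K. \<omega> (t + u) - \<omega> u < c}" for u
    using tele[of _ "\<lambda>i. _ (r i + u)"] KT zT \<iota>(2)
    by (auto simp: C_def space_PiM space_P split_beta)
  have inc [measurable]: "(\<lambda>\<omega>. \<lambda>i\<in>{..<n}. \<omega> (r (Suc i) + u) - \<omega> (r i + u)) \<in> measurable P (\<Pi>\<^sub>M i\<in>{..<n}. borel)" for u
    by measurable
  have law: "emeasure P {\<omega> \<in> Omega0. \<forall>(t, c)\<in>K. \<omega> (t + u) - \<omega> u < c}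
      = emeasure (\<Pi>\<^sub>M i\<in>{..<n}. density lborel (normal_density 0 (sqrt (\<delta> i)))) C" if "- u \<in> T" for u
  proof -
    have "distr P (\<Pi>\<^sub>M i\<in>{..<n}. borel) (\<lambda>\<omega>. \<lambda>i\<in>{..<n}. \<omega> (r (Suc i) + u) - \<omega> (r i + u))
        = (\<Pi>\<^sub>M i\<in>{..<n}. density lborel (normal_density 0 (sqrt (\<delta> i))))"
      by (rule grid_law[where r = "\<lambda>i. r i + u" and m = "\<iota> (- u)"])
        (use r \<iota> that \<delta> in \<open>auto simp: strict_mono_on_def \<delta>_def\<close>)
    from this[symmetric] show ?thesis using C by (simp add: emeasure_distr pre)
  qed
  have "emeasure (distr P P (levy_shift h)) X = emeasure P (levy_shift h -` X \<inter> space P)"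
    using path_cylinder_sets[OF K, of 0] by (intro emeasure_distr) (auto simp: X sets_P)
  also have "levy_shift h -` X \<inter> space P = {\<omega> \<in> Omega0. \<forall>(t, c)\<in>K. \<omega> (t + h) - \<omega> h < c}"
  proof -
    have "levy_shift h \<omega> \<in> X \<longleftrightarrow> (\<forall>(t, c)\<in>K. \<omega> (t + h) - \<omega> h < c)" if "\<omega> \<in> Omega0" for \<omega>
      using levy_shift_in_Omega0[OF that, of h]
      by (simp add: X path_cylinder_def) (simp add: levy_shift_def add.commute)
    then show ?thesis by (auto simp: space_P)
  qed
  also have "emeasure P \<dots> = emeasure P {\<omega> \<in> Omega0. \<forall>(t, c)\<in>K. \<omega> (t + 0) - \<omega> 0 < c}"
    using law[of h] law[of 0] zT by simp
  also have "{\<omega> \<in> Omega0. \<forall>(t, c)\<in>K. \<omega> (t + 0) - \<omega> 0 < c} = X" by (simp add: X path_cylinder_def)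
  finally show "emeasure (distr P P (levy_shift h)) X = emeasure P X" .
next
  show "range (\<lambda>_. Omega0) \<subseteq> {path_cylinder 0 K | K. finite K}"
    using exI[of "\<lambda>K. Omega0 = path_cylinder 0 K \<and> finite K" "{}"] by (simp add: path_cylinder_def)
  show "emeasure (distr P P (levy_shift h)) Omega0 \<noteq> \<infinity>" for i :: nat
    using P.prob_space_distr[OF levy_shift_measurable_P] prob_space.finite_measure
      finite_measure.emeasure_finite by (metis infinity_ennreal_def)
qed (use Int_stable_path_cylinder sets_path_space[of 0] sets_P in \<open>auto simp: path_cylinder_def\<close>)

lemma increment_distributed:
  assumes "s < t"
  shows "distributed P lborel (\<lambda>\<omega>. \<omega> t - \<omega> s) (normal_density 0 (sqrt (t - s)))"
proof -
  have "distributed (distr P P (levy_shift s)) lborel (\<lambda>\<omega>. \<omega> (t - s) - \<omega> 0) (normal_density 0 (sqrt (t - s - 0)))"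
    unfolding distr_levy_shift by (rule increment_distributed_side) (use assms in auto)
  then show ?thesis
    unfolding distributed_def by (simp add: distr_distr comp_def levy_shift_def)
qed

text \<open>The fourth moment is quadratic in the length, so its sum over \<open>n\<close> equal
  cells still tends to 0; the variances would add up to a constant.\<close>

lemma increment_fourth_moment:
  assumes "s \<le> t"
  shows "integrable P (\<lambda>\<omega>. (\<omega> t - \<omega> s) ^ 4)" "P.expectation (\<lambda>\<omega>. (\<omega> t - \<omega> s) ^ 4) = 3 * (t - s)\<^sup>2"
proof -
  have "integrable P (\<lambda>\<omega>. (\<omega> t - \<omega> s) ^ 4) \<and> P.expectation (\<lambda>\<omega>. (\<omega> t - \<omega> s) ^ 4) = 3 * (t - s)\<^sup>2"
  proof (cases "s = t")
    case False
    with assms have st: "s < t" by simp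
    then have pos: "0 < sqrt (t - s)" by simp
    note D = increment_distributed[OF st]
    have hb: "has_bochner_integral lborel (\<lambda>x. normal_density 0 (sqrt (t - s)) x * x ^ 4) (3 * (t - s)\<^sup>2)"
    proof -
      have "fact (2 * 2) / ((2 / (sqrt (t - s))\<^sup>2)\<^sup>2 * fact 2) = 3 * (t - s)\<^sup>2"
        using st by (simp add: fact_numeral power_divide)
      with normal_moment_even[OF pos, of 0 2] show ?thesis by simp
    qed
    have "integrable P (\<lambda>\<omega>. (\<omega> t - \<omega> s) ^ 4)"
      using distributed_integrable[OF D, of "\<lambda>x. x ^ 4"] hb by (auto simp: has_bochner_integral_iff)
    moreover have "P.expectation (\<lambda>\<omega>. (\<omega> t - \<omega> s) ^ 4) = 3 * (t - s)\<^sup>2"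
      using distributed_integral[OF D, of "\<lambda>x. x ^ 4"] hb by (auto simp: has_bochner_integral_iff)
    ultimately show ?thesis ..
  qed simp
  then show "integrable P (\<lambda>\<omega>. (\<omega> t - \<omega> s) ^ 4)" "P.expectation (\<lambda>\<omega>. (\<omega> t - \<omega> s) ^ 4) = 3 * (t - s)\<^sup>2" by auto
qed

end

section \<open>Independence of past and future\<close>

context two_sided_wiener
begin

abbreviation "W \<equiv> completion P"

sublocale W: prob_space W
  by (rule prob_spaceI) (simp add: P.emeasure_space_1)

abbreviation "half_paths \<equiv> \<Pi>\<^sub>M t\<in>{0::real..}. borel :: real measure"

text \<open>Time runs backwards from \<open>v\<close>, as in the definition of the two-sided
  measure: on \<open>Omega0\<close>, \<open>past 0\<close> and \<open>future 0\<close> are the two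
  half-paths assumed independent there.\<close>

definition past :: "real \<Rightarrow> (real \<Rightarrow> real) \<Rightarrow> real \<Rightarrow> real" where
  "past v \<omega> = (\<lambda>t\<in>{0..}. \<omega> (v - t) - \<omega> v)"

definition future :: "real \<Rightarrow> (real \<Rightarrow> real) \<Rightarrow> real \<Rightarrow> real" where
  "future v \<omega> = (\<lambda>t\<in>{0..}. \<omega> (v + t) - \<omega> v)"

lemma past_measurable [measurable]: "past v \<in> measurable P half_paths"
  unfolding past_def by measurable

lemma future_measurable [measurable]: "future v \<in> measurable P half_paths"
  unfolding future_def by measurable

lemma coordinate_measurable_W [measurable]: "(\<lambda>\<omega>. \<omega> t) \<in> borel_measurable W"
  by (rule measurable_completion) measurable

lemma subalgebra_incr_field: "subalgebra W (incr_field W s t)"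
  unfolding subalgebra_def
proof
  show "sets (incr_field W s t) \<subseteq> sets W"
    unfolding sets_incr_field
  proof (rule sets.sigma_sets_subset, safe)
    fix u v and A :: "real set" assume "A \<in> sets borel"
    then show "{\<omega> \<in> space W. \<omega> v - \<omega> u \<in> A} \<in> sets W" by measurable
  qed
qed simp

lemma subalgebra_incr_field_mono:
  assumes "s' \<le> s" "t \<le> t'"
  shows "subalgebra (incr_field W s' t') (incr_field W s t)"
  unfolding subalgebra_def
proof
  show "sets (incr_field W s t) \<subseteq> sets (incr_field W s' t')"
    unfolding sets_incr_field using assms
    by (intro sigma_sets_mono' Un_mono subset_refl) (blast intro: order_trans)
qed simp

lemma increment_measurable_incr_field:
  assumes "s \<le> ereal u" "ereal u \<le> t" "s \<le> ereal v" "ereal v \<le> t"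
  shows "(\<lambda>\<omega>. \<omega> v - \<omega> u) \<in> borel_measurable (incr_field W s t)"
proof -
  have up: "(\<lambda>\<omega>. \<omega> v - \<omega> u) \<in> borel_measurable (incr_field W s t)"
    if "s \<le> ereal u" "u \<le> v" "ereal v \<le> t" for u v
  proof (rule measurableI)
    fix A :: "real set" assume "A \<in> sets borel"
    with that show "(\<lambda>\<omega>. \<omega> v - \<omega> u) -` A \<inter> space (incr_field W s t) \<in> sets (incr_field W s t)"
      unfolding sets_incr_field by (intro sigma_sets.Basic UnI1) (auto simp: vimage_def Int_def conj_commute)
  qed simp
  show ?thesis
  proof (cases "u \<le> v")
    case False
    then have "(\<lambda>\<omega>. - (\<omega> u - \<omega> v)) \<in> borel_measurable (incr_field W s t)"
      using up[of v u] assms by (intro borel_measurable_uminus) auto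
    then show ?thesis by simp
  qed (use up assms in auto)
qed

text \<open>The increment fields contain all null sets of the completion, so an event of such a
  field is determined by the half-path only up to a null set. Induction over the generated
  sigma-field leaves only single increments to be checked.\<close>

lemma incr_field_AE_vimage:
  assumes A: "A \<in> sets (incr_field W s t)" and \<Phi>: "\<Phi> \<in> measurable P N"
    and gen: "\<And>u v B. s \<le> ereal u \<Longrightarrow> u \<le> v \<Longrightarrow> ereal v \<le> t \<Longrightarrow> B \<in> sets (borel :: real measure) \<Longrightarrow>
      \<exists>X\<in>sets N. \<forall>\<omega>\<in>space P. \<omega> v - \<omega> u \<in> B \<longleftrightarrow> \<Phi> \<omega> \<in> X"
  shows "\<exists>X\<in>sets N. AE \<omega> in W. \<omega> \<in> A \<longleftrightarrow> \<Phi> \<omega> \<in> X"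
  using A unfolding sets_incr_field
proof (induction A rule: sigma_sets.induct)
  case (Basic A)
  then consider (incr) u v B where "s \<le> ereal u" "u \<le> v" "ereal v \<le> t" "B \<in> sets (borel :: real measure)"
      "A = {\<omega> \<in> space W. \<omega> v - \<omega> u \<in> B}"
    | (null) "A \<in> sets W" "emeasure W A = 0" | (full) "A \<in> sets W" "emeasure W A = 1" by blast
  then show ?case
  proof cases
    case incr
    from gen[OF incr(1-4)] obtain X where "X \<in> sets N" "\<forall>\<omega>\<in>space P. \<omega> v - \<omega> u \<in> B \<longleftrightarrow> \<Phi> \<omega> \<in> X" by blast
    then show ?thesis unfolding incr(5) by (intro bexI[of _ X] AE_I2) auto
  next
    case null
    then have "AE \<omega> in W. \<omega> \<notin> A" by (intro AE_not_in) (simp only: null_sets_def mem_Collect_eq simp_thms)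
    then show ?thesis by (intro bexI[of _ "{}"]) auto
  next
    case full
    then have "AE \<omega> in W. \<omega> \<in> A" by (simp add: W.AE_in_set_eq_1 W.emeasure_eq_measure del: emeasure_completion)
    moreover have "AE \<omega> in W. \<Phi> \<omega> \<in> space N"
      using measurable_space[OF \<Phi>] by (intro AE_I2) auto
    ultimately have "AE \<omega> in W. \<omega> \<in> A \<longleftrightarrow> \<Phi> \<omega> \<in> space N" by eventually_elim blast
    then show ?thesis by (intro bexI[of _ "space N"]) auto
  qed
next
  case Empty
  then show ?case by (intro bexI[of _ "{}"]) auto
next
  case (Compl A)
  then obtain X where X: "X \<in> sets N" "AE \<omega> in W. \<omega> \<in> A \<longleftrightarrow> \<Phi> \<omega> \<in> X" by blast
  have "AE \<omega> in W. \<omega> \<in> space W - A \<longleftrightarrow> \<Phi> \<omega> \<in> space N - X"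
    using X(2) AE_space[of W] by eventually_elim (use measurable_space[OF \<Phi>] in auto)
  then show ?case using X(1) by blast
next
  case (Union A)
  then have "\<forall>i. \<exists>X. X \<in> sets N \<and> (AE \<omega> in W. \<omega> \<in> A i \<longleftrightarrow> \<Phi> \<omega> \<in> X)" by blast
  from choice[OF this] obtain X where
    X: "\<And>i. X i \<in> sets N" "\<And>i. AE \<omega> in W. \<omega> \<in> A i \<longleftrightarrow> \<Phi> \<omega> \<in> X i" by blast
  have "AE \<omega> in W. \<forall>i. \<omega> \<in> A i \<longleftrightarrow> \<Phi> \<omega> \<in> X i" using X(2) by (simp add: AE_all_countable)
  then have "AE \<omega> in W. \<omega> \<in> (\<Union>i. A i) \<longleftrightarrow> \<Phi> \<omega> \<in> (\<Union>i. X i)" by eventually_elim auto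
  then show ?case using X(1) by blast
qed

lemma prob_levy_shift:
  assumes "Q \<in> sets P"
  shows "P.prob (levy_shift v -` Q \<inter> space P) = P.prob Q"
  using measure_distr[OF levy_shift_measurable_P assms, of v] by (simp add: distr_levy_shift)

text \<open>Up to null sets, both events are conditions on the half-paths at \<open>v\<close>. The
  shift by \<open>v\<close> preserves the measure and carries them to the half-paths at 0, which are
  independent by assumption.\<close>

lemma indep_past_future:
  assumes A: "A \<in> sets (incr_field W (-\<infinity>) (ereal v))" and B: "B \<in> sets (incr_field W (ereal v) \<infinity>)"
  shows "W.prob (A \<inter> B) = W.prob A * W.prob B"
proof -
  have "\<exists>X\<in>sets half_paths. AE \<omega> in W. \<omega> \<in> A \<longleftrightarrow> past v \<omega> \<in> X"
  proof (rule incr_field_AE_vimage[OF A past_measurable])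
    fix s t and C :: "real set" assume st: "s \<le> t" "ereal t \<le> ereal v" and C [measurable]: "C \<in> sets borel"
    have [measurable]: "v - t \<in> {0..}" "v - s \<in> {0..}" using st by auto
    have "{x \<in> space half_paths. x (v - t) - x (v - s) \<in> C} \<in> sets half_paths" by measurable
    then show "\<exists>X\<in>sets half_paths. \<forall>\<omega>\<in>space P. \<omega> t - \<omega> s \<in> C \<longleftrightarrow> past v \<omega> \<in> X"
      using st by (rule_tac bexI) (auto simp: past_def space_PiM)
  qed
  then obtain X where X [measurable]: "X \<in> sets half_paths" and AX: "AE \<omega> in W. \<omega> \<in> A \<longleftrightarrow> past v \<omega> \<in> X" by blast
  have "\<exists>X\<in>sets half_paths. AE \<omega> in W. \<omega> \<in> B \<longleftrightarrow> future v \<omega> \<in> X"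
  proof (rule incr_field_AE_vimage[OF B future_measurable])
    fix s t and C :: "real set" assume st: "s \<le> t" "ereal v \<le> ereal s" and C [measurable]: "C \<in> sets borel"
    have [measurable]: "t - v \<in> {0..}" "s - v \<in> {0..}" using st by auto
    have "{x \<in> space half_paths. x (t - v) - x (s - v) \<in> C} \<in> sets half_paths" by measurable
    then show "\<exists>X\<in>sets half_paths. \<forall>\<omega>\<in>space P. \<omega> t - \<omega> s \<in> C \<longleftrightarrow> future v \<omega> \<in> X"
      using st by (rule_tac bexI) (auto simp: future_def space_PiM)
  qed
  then obtain Y where Y [measurable]: "Y \<in> sets half_paths" and BY: "AE \<omega> in W. \<omega> \<in> B \<longleftrightarrow> future v \<omega> \<in> Y" by blast
  have AM: "A \<in> sets W" and BM: "B \<in> sets W"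
    using A B subalgebra_incr_field by (auto simp: subalgebra_def)
  define X0 Y0 where "X0 = past 0 -` X \<inter> space P" and "Y0 = future 0 -` Y \<inter> space P"
  have [measurable]: "X0 \<in> sets P" "Y0 \<in> sets P" by (auto simp: X0_def Y0_def)
  have sh: "past v \<omega> = past 0 (levy_shift v \<omega>)" "future v \<omega> = future 0 (levy_shift v \<omega>)" for \<omega>
    by (auto simp: past_def future_def levy_shift_def)
  \<comment> \<open>Moves probabilities from the completion at time \<open>v\<close> to the
    uncompleted measure at time 0.\<close>
  have Pr: "W.prob C = P.prob Q" if "C \<in> sets W" "Q \<in> sets P" "AE \<omega> in W. \<omega> \<in> C \<longleftrightarrow> levy_shift v \<omega> \<in> Q" for C Q
  proof -
    have "W.prob C = W.prob (levy_shift v -` Q \<inter> space P)"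
    proof (rule measure_eq_AE)
      show "AE \<omega> in W. \<omega> \<in> C \<longleftrightarrow> \<omega> \<in> levy_shift v -` Q \<inter> space P"
        using that(3) AE_space[of W] by eventually_elim simp
    qed (use that in auto)
    also have "\<dots> = P.prob Q" using prob_levy_shift[OF that(2), of v] that(2) by simp
    finally show ?thesis .
  qed
  have shP: "levy_shift v \<omega> \<in> space P" if "\<omega> \<in> space W" for \<omega>
    using levy_shift_in_Omega0 that by (simp add: space_P)
  have A0: "AE \<omega> in W. \<omega> \<in> A \<longleftrightarrow> levy_shift v \<omega> \<in> X0"
    using AX AE_space[of W] by eventually_elim (use shP in \<open>auto simp: X0_def sh\<close>)
  have B0: "AE \<omega> in W. \<omega> \<in> B \<longleftrightarrow> levy_shift v \<omega> \<in> Y0"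
    using BY AE_space[of W] by eventually_elim (use shP in \<open>auto simp: Y0_def sh\<close>)
  have "AE \<omega> in W. \<omega> \<in> A \<inter> B \<longleftrightarrow> levy_shift v \<omega> \<in> X0 \<inter> Y0"
    using A0 B0 by eventually_elim auto
  then have "W.prob (A \<inter> B) = P.prob (X0 \<inter> Y0)" using AM BM by (intro Pr) auto
  also have "\<dots> = P.prob ((\<lambda>\<omega>. (\<lambda>t\<in>{0..}. \<omega> t, \<lambda>t\<in>{0..}. \<omega> (- t))) -` (Y \<times> X) \<inter> space P)"
    by (intro arg_cong[where f = P.prob])
      (auto simp: X0_def Y0_def past_def future_def space_P Omega0_def restrict_def cong: if_cong)
  also have "\<dots> = P.prob ((\<lambda>\<omega>. \<lambda>t\<in>{0..}. \<omega> t) -` Y \<inter> space P) * P.prob ((\<lambda>\<omega>. \<lambda>t\<in>{0..}. \<omega> (- t)) -` X \<inter> space P)"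
    by (rule P.indep_varD[OF indep_sides Y X])
  also have "(\<lambda>\<omega>. \<lambda>t\<in>{0..}. \<omega> t) -` Y \<inter> space P = Y0"
    by (auto simp: Y0_def future_def space_P Omega0_def)
  also have "(\<lambda>\<omega>. \<lambda>t\<in>{0..}. \<omega> (- t)) -` X \<inter> space P = X0"
    by (auto simp: X0_def past_def space_P Omega0_def)
  also have "P.prob Y0 = W.prob B" using BM B0 by (intro Pr[symmetric]) auto
  also have "P.prob X0 = W.prob A" using AM A0 by (intro Pr[symmetric]) auto
  finally show ?thesis by simp
qed

lemma future_measurable_incr_field: "future v \<in> measurable (incr_field W (ereal v) \<infinity>) half_paths"
  unfolding future_def
  by (rule measurable_restrict) (auto intro!: increment_measurable_incr_field)

text \<open>Shift invariance is known for \<open>P\<close> only, while \<open>B\<close> may use null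
  sets of the completion. So \<open>B\<close> is replaced by a \<open>P\<close>-measurable core
  \<open>Q\<close>; since the shift preserves \<open>P\<close>, the exceptional set remains null
  after shifting.\<close>

lemma prob_levy_shift_W:
  assumes A: "A \<in> sets W" and B: "B \<in> sets W" and AE: "AE \<omega> in W. \<omega> \<in> A \<longleftrightarrow> levy_shift v \<omega> \<in> B"
  shows "W.prob A = W.prob B"
proof -
  obtain Q N N' where Q: "B = Q \<union> N" "N \<subseteq> N'" "N' \<in> null_sets P" "Q \<in> sets P"
    using B by (rule sets_completionE)
  have N: "AE \<omega> in P. \<omega> \<in> B \<longleftrightarrow> \<omega> \<in> Q"
    using AE_not_in[OF Q(3)] by eventually_elim (use Q in auto)
  then have "AE \<omega> in distr P P (levy_shift v). \<omega> \<in> B \<longleftrightarrow> \<omega> \<in> Q"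
    unfolding distr_levy_shift .
  from AE_completion[OF AE_distrD[OF levy_shift_measurable_P this]]
  have "AE \<omega> in W. \<omega> \<in> A \<longleftrightarrow> \<omega> \<in> levy_shift v -` Q \<inter> space P"
    using AE AE_space[of W] by eventually_elim simp
  then have "W.prob A = W.prob (levy_shift v -` Q \<inter> space P)"
    using A Q by (intro measure_eq_AE) auto
  also have "\<dots> = W.prob Q" using prob_levy_shift[OF Q(4), of v] Q(4) by simp
  also have "\<dots> = W.prob B"
    using B Q AE_completion[OF N] by (intro measure_eq_AE) auto
  finally show ?thesis .
qed

end

section \<open>Weak convergence of compensated indicators\<close>

text \<open>Large deviations beyond \<open>r\<close> are charged to the fourth moment. The free
  radius \<open>r\<close> is later balanced against the number of cells.\<close>

lemma abs_le_fourth_power: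
  fixes x r :: real
  assumes "r > 0"
  shows "\<bar>x\<bar> \<le> r + x ^ 4 / r ^ 3"
proof (cases "\<bar>x\<bar> \<le> r")
  case True
  then show ?thesis using assms by (smt (verit) zero_le_even_power divide_nonneg_nonneg zero_less_power even_numeral)
next
  case False
  then have "\<bar>x\<bar> * r ^ 3 \<le> \<bar>x\<bar> * \<bar>x\<bar> ^ 3" using assms by (intro mult_left_mono power_mono) auto
  also have "\<dots> = x ^ 4" by (simp add: power_abs[symmetric] numeral_eq_Suc abs_mult)
  finally have "\<bar>x\<bar> \<le> x ^ 4 / r ^ 3" using assms by (simp add: pos_le_divide_eq)
  then show ?thesis using assms by simp
qed

text \<open>The cells with index below \<open>n\<close> partition the window; larger indices give
  points beyond \<open>w'\<close>. For \<open>n = 0\<close> the division yields 0 and all points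
  collapse to \<open>w\<close>. Points are thus defined and monotone for all indices.\<close>

definition grid :: "real \<Rightarrow> real \<Rightarrow> nat \<Rightarrow> nat \<Rightarrow> real" where
  "grid w w' n j = w + real j * ((w' - w) / real n)"

text \<open>Abstracts from the stopping time: in each cell there is an event decided by its right
  end, with a conditional probability given the past of its left end.\<close>

locale compensated_indicators = two_sided_wiener +
  fixes w w' :: real and E :: "nat \<Rightarrow> nat \<Rightarrow> (real \<Rightarrow> real) set"
    and p :: "nat \<Rightarrow> nat \<Rightarrow> (real \<Rightarrow> real) \<Rightarrow> real"
  assumes ww: "w < w'"
    and E: "\<And>n j. E n j \<in> sets (incr_field W (-\<infinity>) (ereal (grid w w' n (Suc j))))"
    and disj: "\<And>n. disjoint_family (E n)"
    and p: "\<And>n j. p n j \<in> borel_measurable (incr_field W (-\<infinity>) (ereal (grid w w' n j)))"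
      "\<And>n j x. 0 \<le> p n j x" "\<And>n j x. p n j x \<le> 1"
    and cond: "\<And>n j f C. f \<in> borel_measurable (incr_field W (-\<infinity>) (ereal (grid w w' n j))) \<Longrightarrow>
      (\<And>x. \<bar>f x\<bar> \<le> C) \<Longrightarrow>
      W.expectation (\<lambda>x. p n j x * f x) = W.expectation (\<lambda>x. indicator (E n j) x * f x)"
begin

abbreviation "v \<equiv> grid w w'"
abbreviation "F n j \<equiv> incr_field W (-\<infinity>) (ereal (v n j))"

definition comp :: "nat \<Rightarrow> (real \<Rightarrow> real) \<Rightarrow> real" where
  "comp n \<omega> = (\<Sum>j<n. indicator (E n j) \<omega> - p n j \<omega>)"

lemma v_Suc: "v n (Suc j) = v n j + (w' - w) / real n"
  by (simp add: grid_def algebra_simps add_divide_distrib diff_divide_distrib)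

lemma v_mono: "v n j \<le> v n (Suc j)"
  using ww by (simp add: v_Suc)

lemma w_le_v: "w \<le> v n j"
  using ww by (simp add: grid_def)

lemma subalgebra_F: "subalgebra W (F n j)" "subalgebra (F n (Suc j)) (F n j)"
  by (rule subalgebra_incr_field) (rule subalgebra_incr_field_mono, use v_mono in auto)

lemma E_W [measurable]: "E n j \<in> sets W"
  using E[of n j] subalgebra_F(1)[of n "Suc j"] by (auto simp: subalgebra_def)

lemma E_Int_space [simp]: "E n j \<inter> space P = E n j"
  using sets.Int_space_eq2[OF E_W] by simp

lemma p_W [measurable]: "p n j \<in> borel_measurable W"
  by (rule measurable_from_subalg[OF subalgebra_F(1) p(1)])

lemma comp_W [measurable]: "comp n \<in> borel_measurable W"
  unfolding comp_def by measurable

text \<open>The second bound is the economical one: its expectation is twice the probability of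
  \<open>E n j\<close>, so the sum over all cells is at most 2, whereas the first bound adds up to
  \<open>n\<close>.\<close>

lemma xi_bound: "\<bar>indicator (E n j) \<omega> - p n j \<omega>\<bar> \<le> 1"
    "\<bar>indicator (E n j) \<omega> - p n j \<omega>\<bar> \<le> indicator (E n j) \<omega> + p n j \<omega>"
  using p(2,3)[of n j \<omega>] by (auto simp: indicator_def)

lemma comp_bound: "\<bar>comp n \<omega>\<bar> \<le> real n"
proof -
  have "\<bar>comp n \<omega>\<bar> \<le> (\<Sum>j<n. \<bar>indicator (E n j) \<omega> - p n j \<omega>\<bar>)" unfolding comp_def by (rule sum_abs)
  also have "\<dots> \<le> (\<Sum>j<n. 1)" by (rule sum_mono) (rule xi_bound)
  finally show ?thesis by simp
qed

lemma comp_L2: "W.expectation (\<lambda>\<omega>. (comp n \<omega>)\<^sup>2) \<le> 1"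
  unfolding comp_def
proof (rule W.compensated_sum_L2[where F = "F n"])
  show "W.expectation (\<lambda>x. p n j x * f x) = W.expectation (\<lambda>x. indicator (E n j) x * f x)"
    if "f \<in> borel_measurable (F n j)" "\<And>x. \<bar>f x\<bar> \<le> C" for j f C
    using that by (rule cond)
qed (use subalgebra_F E disj p in auto)

lemma integrable_comp_mult:
  assumes [measurable]: "f \<in> borel_measurable W" and b: "\<And>x. \<bar>f x\<bar> \<le> 1"
  shows "integrable W (\<lambda>x. comp n x * f x)"
  using mult_mono[OF comp_bound b]
  by (intro W.integrable_bounded[where C = "real n * 1"]) (auto simp: abs_mult)

lemma expectation_p: "W.expectation (p n j) = W.prob (E n j)"
  using cond[of "\<lambda>_. 1" n j 1] by simp

lemma expectation_comp: "W.expectation (comp n) = 0"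
proof -
  have "integrable W (p n j)" for j by (rule W.integrable_bounded[where C = 1]) (use p in auto)
  moreover have "integrable W (indicator (E n j) :: _ \<Rightarrow> real)" for j
    by (rule W.integrable_bounded[where C = 1]) (auto simp: indicator_def)
  ultimately show ?thesis unfolding comp_def by (simp add: expectation_p)
qed

section \<open>Weak limit on Lipschitz functionals of finitely many increments\<close>

text \<open>Removing from a path its increment over \<open>[v n j, v n (Suc j)]\<close> makes a functional
  orthogonal to the \<open>j\<close>-th compensated indicator, which depends on the path up to time
  \<open>v n (Suc j)\<close> only and is centred given the path up to time \<open>v n j\<close>.\<close>

definition gap :: "nat \<Rightarrow> nat \<Rightarrow> real \<Rightarrow> (real \<Rightarrow> real) \<Rightarrow> real" where
  "gap n j t \<omega> = \<omega> (min t (v n (Suc j))) - \<omega> (min t (v n j))"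

lemma gap_W [measurable]: "gap n j t \<in> borel_measurable W"
  unfolding gap_def by measurable

text \<open>The functional without the gap combines \<open>U\<close>, known at the left end of the
  cell, with \<open>V\<close>, the future after its right end. Integrating \<open>V\<close> out,
  given all that is known at the right end, leaves \<open>\<psi>\<close> of \<open>U\<close>. This
  is known at the left end, where the indicator and \<open>p n j\<close> have equal expectations
  against it.\<close>

lemma orthogonal_without_gap:
  fixes g :: "real \<Rightarrow> real \<Rightarrow> real"
  assumes K: "finite K" and g: "\<And>c. g c \<in> borel_measurable borel" "\<And>c x. 0 \<le> g c x" "\<And>c x. g c x \<le> 1"
  shows "W.expectation (\<lambda>\<omega>. (indicator (E n j) \<omega> - p n j \<omega>) *
    (\<Prod>k\<in>K. g (snd k) (\<omega> (fst k) - \<omega> w - gap n j (fst k) \<omega>))) = 0"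
proof -
  note [measurable] = g(1)
  define V where "V = future (v n (Suc j))"
  define U :: "(real \<Rightarrow> real) \<Rightarrow> real \<times> real \<Rightarrow> real" where "U = (\<lambda>\<omega>. \<lambda>k\<in>K. \<omega> (min (fst k) (v n j)) - \<omega> w)"
  \<comment> \<open>Each argument of \<open>g\<close> is the increment up to the left end plus the
    increment after the right end. The truncation by \<open>max\<close> makes the second part 0 for
    times before the right end.\<close>
  define \<phi> where "\<phi> = (\<lambda>(u, f). \<Prod>k\<in>K. g (snd k) (u k + f (max 0 (fst k - v n (Suc j)))))"
  define \<psi> where "\<psi> = (\<lambda>u. W.expectation (\<lambda>y. \<phi> (u, V y)))"
  define Z where "Z = (\<lambda>\<omega>. \<Prod>k\<in>K. g (snd k) (\<omega> (fst k) - \<omega> w - gap n j (fst k) \<omega>))"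
  have V [measurable]: "V \<in> measurable W half_paths"
    unfolding V_def by (rule measurable_completion) measurable
  have UF: "U \<in> measurable (F n j) (PiM K (\<lambda>_. borel))"
    unfolding U_def using w_le_v
    by (intro measurable_restrict) (auto intro!: increment_measurable_incr_field)
  have UF': "U \<in> measurable (F n (Suc j)) (PiM K (\<lambda>_. borel))"
    by (rule measurable_from_subalg[OF subalgebra_F(2) UF])
  have max0 [measurable]: "max 0 (x - y) \<in> {0..}" for x y :: real by simp
  have \<phi> [measurable]: "\<phi> \<in> borel_measurable (PiM K (\<lambda>_. borel) \<Otimes>\<^sub>M half_paths)"
    unfolding \<phi>_def by measurable
  have Z_eq: "\<phi> (U \<omega>, V \<omega>) = Z \<omega>" for \<omega>
    unfolding \<phi>_def Z_def split U_def V_def future_def gap_def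
    using v_mono[of n j] by (intro prod.cong refl arg_cong2[where f = g]) (auto simp: min_def max_def)
  have prod01: "0 \<le> (\<Prod>k\<in>K. g (snd k) (y k))" "(\<Prod>k\<in>K. g (snd k) (y k)) \<le> 1" for y :: "real \<times> real \<Rightarrow> real"
    using g by (auto intro!: prod_nonneg prod_le_1)
  have \<phi>01: "0 \<le> \<phi> z" "\<phi> z \<le> 1" for z
    using prod01 by (auto simp: \<phi>_def split_beta)
  have Z [measurable]: "Z \<in> borel_measurable W" unfolding Z_def by measurable
  have Z01: "0 \<le> Z \<omega>" "Z \<omega> \<le> 1" for \<omega> using \<phi>01[of "(U \<omega>, V \<omega>)"] by (simp_all add: Z_eq)
  have \<phi>u [measurable]: "(\<lambda>y. \<phi> (u, V y)) \<in> borel_measurable W" for u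
    unfolding \<phi>_def split by measurable
  have int\<phi>: "integrable W (\<lambda>y. \<phi> (u, V y))" for u
    by (rule W.integrable_bounded[where C = 1]) (use \<phi>01 in auto)
  have \<psi>01: "\<bar>\<psi> u\<bar> \<le> 1" for u
    using W.integral_le_const[OF int\<phi>[of u], of 1] W.integral_ge_const[OF int\<phi>[of u], of 0] \<phi>01 by (simp add: \<psi>_def)
  have \<psi>F: "(\<lambda>\<omega>. \<psi> (U \<omega>)) \<in> borel_measurable (F n j)"
  proof (rule measurable_compose[OF UF])
    show "\<psi> \<in> borel_measurable (PiM K (\<lambda>_. borel))"
      unfolding \<psi>_def by measurable
  qed
  have freeze: "W.expectation (\<lambda>\<omega>. q \<omega> * Z \<omega>) = W.expectation (\<lambda>\<omega>. q \<omega> * \<psi> (U \<omega>))"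
    if q: "q \<in> borel_measurable (F n (Suc j))" and q1: "\<And>x. \<bar>q x\<bar> \<le> 1" for q
  proof -
    note [measurable] = measurable_from_subalg[OF subalgebra_F(1) q]
    have "W.expectation (\<lambda>\<omega>. q \<omega> * \<phi> (U \<omega>, V \<omega>)) = W.expectation (\<lambda>\<omega>. q \<omega> * W.expectation (\<lambda>y. \<phi> (U \<omega>, V y)))"
    proof (rule W.expectation_freeze[OF subalgebra_F(1) V _ UF' q \<phi>])
      fix A B assume A: "A \<in> sets (F n (Suc j))" and B: "B \<in> sets half_paths"
      have "V -` B \<inter> space W \<in> sets (incr_field W (ereal (v n (Suc j))) \<infinity>)"
        using measurable_sets[OF future_measurable_incr_field B] by (simp add: V_def)
      with A show "W.prob (A \<inter> (V -` B \<inter> space W)) = W.prob A * W.prob (V -` B \<inter> space W)"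
        by (rule indep_past_future)
    next
      show "integrable W (\<lambda>x. q x * \<phi> (U x, V x))"
        using mult_mono[OF q1 Z01(2)] Z01(1)
        unfolding Z_eq by (intro W.integrable_bounded[where C = "1 * 1"]) (auto simp: abs_mult)
    qed
    then show ?thesis unfolding Z_eq \<psi>_def .
  qed
  have pF: "p n j \<in> borel_measurable (F n (Suc j))" by (rule measurable_from_subalg[OF subalgebra_F(2) p(1)])
  have EF: "indicator (E n j) \<in> borel_measurable (F n (Suc j))" using E by simp
  have intZ: "integrable W (\<lambda>\<omega>. q \<omega> * Z \<omega>)" if "q \<in> borel_measurable W" "\<And>x. \<bar>q x\<bar> \<le> 1" for q
    using that mult_mono[OF that(2) Z01(2)] Z01(1)
    by (intro W.integrable_bounded[where C = "1 * 1"]) (auto simp: abs_mult)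
  have "W.expectation (\<lambda>\<omega>. (indicator (E n j) \<omega> - p n j \<omega>) * Z \<omega>)
      = W.expectation (\<lambda>\<omega>. indicator (E n j) \<omega> * Z \<omega>) - W.expectation (\<lambda>\<omega>. p n j \<omega> * Z \<omega>)"
    unfolding left_diff_distrib
    by (rule Bochner_Integration.integral_diff) (use p in \<open>auto intro!: intZ simp: indicator_def\<close>)
  also have "W.expectation (\<lambda>\<omega>. indicator (E n j) \<omega> * Z \<omega>) = W.expectation (\<lambda>\<omega>. indicator (E n j) \<omega> * \<psi> (U \<omega>))"
    by (rule freeze[OF EF]) (auto simp: indicator_def)
  also have "\<dots> = W.expectation (\<lambda>\<omega>. p n j \<omega> * \<psi> (U \<omega>))"
    using cond[OF \<psi>F \<psi>01] by simp
  also have "\<dots> = W.expectation (\<lambda>\<omega>. p n j \<omega> * Z \<omega>)"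
    by (rule freeze[OF pF, symmetric]) (use p in auto)
  finally show ?thesis by (simp add: Z_def)
qed

lemma gap_fourth_moment:
  "integrable W (\<lambda>\<omega>. (gap n j t \<omega>) ^ 4)"
  "W.expectation (\<lambda>\<omega>. (gap n j t \<omega>) ^ 4) \<le> 3 * ((w' - w) / real n)\<^sup>2"
proof -
  define a b where "a = min t (v n j)" and "b = min t (v n (Suc j))"
  have ab: "a \<le> b" "b - a \<le> (w' - w) / real n"
    using v_mono[of n j] v_Suc[of n j] by (auto simp: a_def b_def min_def)
  show "integrable W (\<lambda>\<omega>. (gap n j t \<omega>) ^ 4)"
    using increment_fourth_moment(1)[OF ab(1)]
    unfolding gap_def a_def[symmetric] b_def[symmetric] by (subst integrable_completion) auto
  have "W.expectation (\<lambda>\<omega>. (gap n j t \<omega>) ^ 4) = 3 * (b - a)\<^sup>2"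
    using increment_fourth_moment(2)[OF ab(1)]
    unfolding gap_def a_def[symmetric] b_def[symmetric] by (subst integral_completion) auto
  also have "\<dots> \<le> 3 * ((w' - w) / real n)\<^sup>2" using ab by (intro mult_left_mono power_mono) auto
  finally show "W.expectation (\<lambda>\<omega>. (gap n j t \<omega>) ^ 4) \<le> 3 * ((w' - w) / real n)\<^sup>2" .
qed

text \<open>On each cell, \<open>Z\<close> may be replaced by the functional \<open>Z'\<close>
  without the gap, to which the compensated indicator is orthogonal. The error is at most Lipschitz
  in the gaps, and the fourth moments make the sum of all errors vanish.\<close>

lemma weak_limit_Lipschitz:
  fixes g :: "real \<Rightarrow> real \<Rightarrow> real"
  assumes K: "finite K" and g: "\<And>c. g c \<in> borel_measurable borel" "\<And>c x. 0 \<le> g c x" "\<And>c x. g c x \<le> 1"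
    and L: "\<And>c x y. \<bar>g c x - g c y\<bar> \<le> L * \<bar>x - y\<bar>" "0 \<le> L"
  shows "(\<lambda>n. W.expectation (\<lambda>\<omega>. comp n \<omega> * (\<Prod>k\<in>K. g (snd k) (\<omega> (fst k) - \<omega> w)))) \<longlonglongrightarrow> 0"
proof -
  note [measurable] = g(1)
  define Z where "Z = (\<lambda>\<omega>. \<Prod>k\<in>K. g (snd k) (\<omega> (fst k) - \<omega> w))"
  define Z' where "Z' = (\<lambda>n j \<omega>. \<Prod>k\<in>K. g (snd k) (\<omega> (fst k) - \<omega> w - gap n j (fst k) \<omega>))"
  have [measurable]: "Z \<in> borel_measurable W" "Z' n j \<in> borel_measurable W" for n j
    unfolding Z_def Z'_def by measurable
  have Z01: "0 \<le> Z \<omega>" "Z \<omega> \<le> 1" "0 \<le> Z' n j \<omega>" "Z' n j \<omega> \<le> 1" for n j \<omega>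
    unfolding Z_def Z'_def using g by (auto intro!: prod_nonneg prod_le_1)
  define c where "c = real (card K)"
  have diff: "\<bar>Z \<omega> - Z' n j \<omega>\<bar> \<le> (\<Sum>k\<in>K. L * \<bar>gap n j (fst k) \<omega>\<bar>)" for n j \<omega>
  proof -
    have "\<bar>Z \<omega> - Z' n j \<omega>\<bar> \<le> (\<Sum>k\<in>K. \<bar>g (snd k) (\<omega> (fst k) - \<omega> w) - g (snd k) (\<omega> (fst k) - \<omega> w - gap n j (fst k) \<omega>)\<bar>)"
      unfolding Z_def Z'_def real_norm_def[symmetric]
      by (rule norm_prod_diff) (use g in auto)
    also have "\<dots> \<le> (\<Sum>k\<in>K. L * \<bar>gap n j (fst k) \<omega>\<bar>)"
      by (rule sum_mono) (rule order_trans[OF L(1)], simp)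
    finally show ?thesis .
  qed
  have step: "\<bar>W.expectation (\<lambda>\<omega>. (indicator (E n j) \<omega> - p n j \<omega>) * Z \<omega>)\<bar>
      \<le> 2 * (L * c * r) * W.prob (E n j) + L * c * (3 * ((w' - w) / real n)\<^sup>2) / r ^ 3"
    if r: "r > 0" for n j r
  proof -
    define \<xi> where "\<xi> = (\<lambda>\<omega>. indicator (E n j) \<omega> - p n j \<omega>)"
    have [measurable]: "\<xi> \<in> borel_measurable W" unfolding \<xi>_def by measurable
    have \<xi>1: "\<bar>\<xi> \<omega>\<bar> \<le> 1" "\<bar>\<xi> \<omega>\<bar> \<le> indicator (E n j) \<omega> + p n j \<omega>" for \<omega> using xi_bound by (auto simp: \<xi>_def)
    have int: "integrable W (\<lambda>\<omega>. \<xi> \<omega> * Z \<omega>)" "integrable W (\<lambda>\<omega>. \<xi> \<omega> * Z' n j \<omega>)"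
      using mult_mono[OF \<xi>1(1) Z01(2)] mult_mono[OF \<xi>1(1) Z01(4)] Z01
      by (auto intro!: W.integrable_bounded[where C = "1 * 1"] simp: abs_mult)
    have int2: "integrable W (indicator (E n j) :: _ \<Rightarrow> real)" "integrable W (p n j)"
      using p by (auto intro!: W.integrable_bounded[where C = 1] simp: indicator_def)
    note int4 = gap_fourth_moment(1)[of n j]
    have pt: "\<bar>\<xi> \<omega> * Z \<omega> - \<xi> \<omega> * Z' n j \<omega>\<bar> \<le>
        (L * c * r) * (indicator (E n j) \<omega> + p n j \<omega>) + (\<Sum>k\<in>K. (L / r ^ 3) * gap n j (fst k) \<omega> ^ 4)" for \<omega>
    proof -
      have "(\<Sum>k\<in>K. L * \<bar>gap n j (fst k) \<omega>\<bar>) \<le> (\<Sum>k\<in>K. L * (r + gap n j (fst k) \<omega> ^ 4 / r ^ 3))"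
        by (intro sum_mono mult_left_mono abs_le_fourth_power r L(2))
      also have "\<dots> = L * c * r + (\<Sum>k\<in>K. (L / r ^ 3) * gap n j (fst k) \<omega> ^ 4)"
        by (simp add: sum.distrib distrib_left c_def)
      finally have "\<bar>Z \<omega> - Z' n j \<omega>\<bar> \<le> L * c * r + (\<Sum>k\<in>K. (L / r ^ 3) * gap n j (fst k) \<omega> ^ 4)"
        using diff[of \<omega> n j] by linarith
      then have "\<bar>\<xi> \<omega>\<bar> * \<bar>Z \<omega> - Z' n j \<omega>\<bar> \<le> \<bar>\<xi> \<omega>\<bar> * (L * c * r + (\<Sum>k\<in>K. (L / r ^ 3) * gap n j (fst k) \<omega> ^ 4))"
        by (rule mult_left_mono) simp
      also have "\<dots> = (L * c * r) * \<bar>\<xi> \<omega>\<bar> + \<bar>\<xi> \<omega>\<bar> * (\<Sum>k\<in>K. (L / r ^ 3) * gap n j (fst k) \<omega> ^ 4)"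
        by (simp add: algebra_simps)
      \<comment> \<open>Two bounds on \<open>\<xi>\<close> are used. The constant part of the error
        keeps the indicator and \<open>p\<close>, whose expectations are summable over the cells;
        the fourth-power part is small enough for the bound by 1.\<close>
      also have "\<dots> \<le> (L * c * r) * (indicator (E n j) \<omega> + p n j \<omega>) + 1 * (\<Sum>k\<in>K. (L / r ^ 3) * gap n j (fst k) \<omega> ^ 4)"
        using r L(2) by (intro add_mono mult_left_mono mult_right_mono \<xi>1 sum_nonneg) (auto simp: c_def)
      finally show ?thesis by (simp add: abs_mult[symmetric] right_diff_distrib)
    qed
    have "W.expectation (\<lambda>\<omega>. \<xi> \<omega> * Z \<omega>) = W.expectation (\<lambda>\<omega>. \<xi> \<omega> * Z \<omega> - \<xi> \<omega> * Z' n j \<omega>)"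
      using orthogonal_without_gap[OF K g, of n j] int by (simp add: \<xi>_def Z'_def)
    also have "\<bar>\<dots>\<bar> \<le> W.expectation (\<lambda>\<omega>. \<bar>\<xi> \<omega> * Z \<omega> - \<xi> \<omega> * Z' n j \<omega>\<bar>)" by (rule integral_abs_bound)
    also have "\<dots> \<le> W.expectation (\<lambda>\<omega>. (L * c * r) * (indicator (E n j) \<omega> + p n j \<omega>) + (\<Sum>k\<in>K. (L / r ^ 3) * gap n j (fst k) \<omega> ^ 4))"
      by (rule integral_mono) (use int int2 int4 pt in \<open>auto intro!: integrable_abs\<close>)
    also have "\<dots> = 2 * (L * c * r) * W.prob (E n j) + (\<Sum>k\<in>K. (L / r ^ 3) * W.expectation (\<lambda>\<omega>. gap n j (fst k) \<omega> ^ 4))"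
      using int2 int4 by (simp add: expectation_p)
    also have "\<dots> \<le> 2 * (L * c * r) * W.prob (E n j) + (\<Sum>k\<in>K. (L / r ^ 3) * (3 * ((w' - w) / real n)\<^sup>2))"
      using r L(2) by (intro add_left_mono sum_mono mult_left_mono gap_fourth_moment(2)) auto
    finally show ?thesis by (simp add: \<xi>_def c_def mult_ac)
  qed
  have total: "\<bar>W.expectation (\<lambda>\<omega>. comp n \<omega> * Z \<omega>)\<bar> \<le> (2 * L * c + 3 * L * c * (w' - w)\<^sup>2) * real n powr (- (1/4))"
    if n: "n > 0" for n
  proof -
    \<comment> \<open>With radius \<open>r = 1 / q\<close> the two contributions, of order
      \<open>r\<close> and \<open>1 / (n r ^ 3)\<close>, are both of order
      \<open>n powr (- (1/4))\<close>.\<close>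
    define q where "q = real n powr (1/4)"
    have q: "q > 0" "real n = q ^ 4" using n by (auto simp: q_def powr_power)
    have int: "integrable W (\<lambda>\<omega>. (indicator (E n j) \<omega> - p n j \<omega>) * Z \<omega>)" for j
      using mult_mono[OF xi_bound(1) Z01(2)] Z01
      by (auto intro!: W.integrable_bounded[where C = "1 * 1"] simp: abs_mult)
    have "W.expectation (\<lambda>\<omega>. comp n \<omega> * Z \<omega>) = (\<Sum>j<n. W.expectation (\<lambda>\<omega>. (indicator (E n j) \<omega> - p n j \<omega>) * Z \<omega>))"
      unfolding comp_def sum_distrib_right by (rule Bochner_Integration.integral_sum) (rule int)
    also have "\<bar>\<dots>\<bar> \<le> (\<Sum>j<n. \<bar>W.expectation (\<lambda>\<omega>. (indicator (E n j) \<omega> - p n j \<omega>) * Z \<omega>)\<bar>)" by (rule sum_abs)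
    also have "\<dots> \<le> (\<Sum>j<n. 2 * (L * c * (1 / q)) * W.prob (E n j) + L * c * (3 * ((w' - w) / real n)\<^sup>2) / (1 / q) ^ 3)"
      by (rule sum_mono, rule step) (use q in auto)
    also have "\<dots> = 2 * (L * c * (1 / q)) * (\<Sum>j<n. W.prob (E n j)) + real n * (L * c * (3 * ((w' - w) / real n)\<^sup>2) / (1 / q) ^ 3)"
      by (simp add: sum.distrib sum_distrib_left)
    also have "\<dots> \<le> 2 * (L * c * (1 / q)) * 1 + real n * (L * c * (3 * ((w' - w) / real n)\<^sup>2) / (1 / q) ^ 3)"
    proof (intro add_right_mono mult_left_mono)
      have "(\<Sum>j<n. W.prob (E n j)) = W.prob (\<Union>j<n. E n j)"
        by (rule W.finite_measure_finite_Union[symmetric])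
          (use disj[of n] in \<open>auto simp: disjoint_family_on_def\<close>)
      then show "(\<Sum>j<n. W.prob (E n j)) \<le> 1" by simp
    qed (use q L(2) in \<open>auto simp: c_def\<close>)
    also have "\<dots> = (2 * L * c + 3 * L * c * (w' - w)\<^sup>2) / q"
      unfolding q(2) using q(1) by (simp add: field_simps power2_eq_square numeral_eq_Suc)
    also have "\<dots> = (2 * L * c + 3 * L * c * (w' - w)\<^sup>2) * real n powr (- (1/4))"
      by (simp add: q_def powr_minus_divide)
    finally show ?thesis .
  qed
  have "(\<lambda>n. (2 * L * c + 3 * L * c * (w' - w)\<^sup>2) * real n powr (- (1/4))) \<longlonglongrightarrow> (2 * L * c + 3 * L * c * (w' - w)\<^sup>2) * 0"
    by (rule tendsto_mult[OF tendsto_const tendsto_neg_powr[OF _ filterlim_real_sequentially]]) simp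
  then have lim: "(\<lambda>n. (2 * L * c + 3 * L * c * (w' - w)\<^sup>2) * real n powr (- (1/4))) \<longlonglongrightarrow> 0"
    by simp
  have "(\<lambda>n. W.expectation (\<lambda>\<omega>. comp n \<omega> * Z \<omega>)) \<longlonglongrightarrow> 0"
  proof (rule Lim_null_comparison[OF _ lim])
    show "\<forall>\<^sub>F n in sequentially. norm (W.expectation (\<lambda>\<omega>. comp n \<omega> * Z \<omega>)) \<le>
        (2 * L * c + 3 * L * c * (w' - w)\<^sup>2) * real n powr (- (1/4))"
      unfolding real_norm_def by (rule eventually_sequentiallyI[of 1], rule total) simp
  qed
  then show ?thesis by (simp add: Z_def)
qed

section \<open>From Lipschitz functionals to all events\<close>

lemma weak_limit_approx:
  assumes D [measurable]: "D \<in> sets W"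
    and approx: "\<And>e. e > 0 \<Longrightarrow> \<exists>f\<in>borel_measurable W. (\<forall>x. 0 \<le> f x \<and> f x \<le> indicator D x) \<and>
      W.expectation (\<lambda>x. indicator D x - f x) < e \<and> (\<lambda>n. W.expectation (\<lambda>x. comp n x * f x)) \<longlonglongrightarrow> 0"
  shows "(\<lambda>n. W.expectation (\<lambda>x. comp n x * indicator D x)) \<longlonglongrightarrow> 0"
proof (rule LIMSEQ_I)
  fix e :: real assume e: "e > 0"
  then obtain f where f [measurable]: "f \<in> borel_measurable W" and f01: "\<And>x. 0 \<le> f x" "\<And>x. f x \<le> indicator D x"
    and fe: "W.expectation (\<lambda>x. indicator D x - f x) < (e / 4)\<^sup>2"
    and lim: "(\<lambda>n. W.expectation (\<lambda>x. comp n x * f x)) \<longlonglongrightarrow> 0"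
    using approx[of "(e / 4)\<^sup>2"] by auto
  have f1: "f x \<le> 1" for x by (rule order_trans[OF f01(2)]) (auto simp: indicator_def)
  \<comment> \<open>The \<open>L\<^sup>2\<close> bound on \<open>comp n\<close> makes this error
    uniform in \<open>n\<close>. Taking \<open>r = e / 4\<close> in \<open>weak_L2_bound\<close>,
    the accuracy \<open>(e / 4)\<^sup>2\<close> of \<open>f\<close> yields two terms of size
    \<open>e / 4\<close>.\<close>
  have tail: "\<bar>W.expectation (\<lambda>x. comp n x * (indicator D x - f x))\<bar> < e / 2" for n
  proof -
    have "\<bar>W.expectation (\<lambda>x. comp n x * (indicator D x - f x))\<bar>
        \<le> e / 4 + W.expectation (\<lambda>x. indicator D x - f x) / (e / 4)"
    proof (rule W.weak_L2_bound[OF comp_W comp_bound comp_L2])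
      show "0 \<le> indicator D x - f x" "indicator D x - f x \<le> 1" for x
        using f01[of x] by (auto simp: indicator_def)
    qed (use e in auto)
    also have "\<dots> < e / 4 + (e / 4)\<^sup>2 / (e / 4)"
      using fe e by (intro add_strict_left_mono divide_strict_right_mono) auto
    also have "\<dots> = e / 2" using e by (simp add: power2_eq_square)
    finally show ?thesis .
  qed
  have split: "W.expectation (\<lambda>x. comp n x * indicator D x) =
      W.expectation (\<lambda>x. comp n x * (indicator D x - f x)) + W.expectation (\<lambda>x. comp n x * f x)" for n
  proof -
    have "\<bar>indicator D x - f x\<bar> \<le> 1" for x using f01[of x] f1[of x] by (auto simp: indicator_def)
    then have "integrable W (\<lambda>x. comp n x * (indicator D x - f x))"
      by (intro integrable_comp_mult) auto
    moreover have "integrable W (\<lambda>x. comp n x * f x)"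
      using f01 f1 by (intro integrable_comp_mult) auto
    ultimately have "W.expectation (\<lambda>x. comp n x * (indicator D x - f x)) + W.expectation (\<lambda>x. comp n x * f x)
      = W.expectation (\<lambda>x. comp n x * (indicator D x - f x) + comp n x * f x)" by simp
    then show ?thesis by (simp add: algebra_simps)
  qed
  obtain N where "\<And>n. n \<ge> N \<Longrightarrow> \<bar>W.expectation (\<lambda>x. comp n x * f x)\<bar> < e / 2"
    using LIMSEQ_D[OF lim, of "e / 2"] e by auto
  then show "\<exists>no. \<forall>n\<ge>no. norm (W.expectation (\<lambda>x. comp n x * indicator D x) - 0) < e"
    using tail split by (intro exI[of _ N]) (smt (verit) real_norm_def field_sum_of_halves)
qed

lemma weak_limit_cylinder:
  assumes K: "finite K"
  shows "(\<lambda>n. W.expectation (\<lambda>x. comp n x * indicator (path_cylinder w K) x)) \<longlonglongrightarrow> 0"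
proof (rule weak_limit_approx)
  define D where "D = path_cylinder w K"
  have D [measurable]: "D \<in> sets W" using path_cylinder_sets[OF K] by (simp add: D_def sets_P)
  then show "path_cylinder w K \<in> sets W" by (simp add: D_def)
  have \<Omega> [measurable]: "Omega0 \<in> sets W" using sets.top[of W] by (simp add: space_P)
  \<comment> \<open>For \<open>m > 0\<close>, a ramp with slope \<open>m\<close> that is 1 up to
    \<open>c - 1 / m\<close> and 0 from \<open>c\<close> on; it tends to the strict indicator from
    below as \<open>m\<close> grows.\<close>
  define g where "g = (\<lambda>(m::nat) c x. min 1 (max 0 (real m * (c - x))))"
  \<comment> \<open>The factor \<open>indicator Omega0\<close> keeps \<open>f m\<close> below the
    indicator of \<open>D\<close> at every function, also outside the path space.\<close>
  define f where "f = (\<lambda>m \<omega>. indicator Omega0 \<omega> * (\<Prod>k\<in>K. g m (snd k) (\<omega> (fst k) - \<omega> w)))"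
  have [measurable]: "g m c \<in> borel_measurable borel" for m c unfolding g_def by measurable
  have fM [measurable]: "f m \<in> borel_measurable W" for m unfolding f_def by measurable
  have g01: "0 \<le> g m c x" "g m c x \<le> 1" for m c x by (auto simp: g_def)
  have f0: "0 \<le> f m \<omega>" for m \<omega> unfolding f_def by (intro mult_nonneg_nonneg prod_nonneg) (auto simp: g01)
  have f1: "f m \<omega> \<le> indicator D \<omega>" for m \<omega>
  proof (cases "\<omega> \<in> D")
    case True
    then show ?thesis using g01 by (auto simp: f_def indicator_def intro!: prod_le_1)
  next
    case False
    show ?thesis
    proof (cases "\<omega> \<in> Omega0")
      case True
      with False obtain k where k: "k \<in> K" "\<not> \<omega> (fst k) - \<omega> w < snd k" by (auto simp: D_def path_cylinder_def)
      then have "real m * (snd k - (\<omega> (fst k) - \<omega> w)) \<le> 0" by (intro mult_nonneg_nonpos) auto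
      then have "g m (snd k) (\<omega> (fst k) - \<omega> w) = 0" by (simp add: g_def)
      with k K have "(\<Prod>k\<in>K. g m (snd k) (\<omega> (fst k) - \<omega> w)) = 0" by (metis (mono_tags, lifting) prod_zero)
      then show ?thesis by (simp add: f_def)
    qed (simp add: f_def)
  qed
  have f_lim: "(\<lambda>m. f m \<omega>) \<longlonglongrightarrow> indicator D \<omega>" for \<omega>
  proof (cases "\<omega> \<in> D")
    case True
    have "(\<lambda>m. g m (snd k) (\<omega> (fst k) - \<omega> w)) \<longlonglongrightarrow> 1" if "k \<in> K" for k
    proof (rule tendsto_eventually)
      define d where "d = snd k - (\<omega> (fst k) - \<omega> w)"
      have d: "d > 0" using True that by (auto simp: D_def path_cylinder_def d_def)
      obtain N where N: "1 / d < real N" using reals_Archimedean2 by blast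
      show "\<forall>\<^sub>F m in sequentially. g m (snd k) (\<omega> (fst k) - \<omega> w) = 1"
      proof (rule eventually_sequentiallyI[of N])
        fix m assume "N \<le> m"
        then have "1 / d \<le> real m" using N by linarith
        then have "1 \<le> real m * d" using d by (simp add: pos_divide_le_eq)
        then show "g m (snd k) (\<omega> (fst k) - \<omega> w) = 1" by (simp add: g_def d_def)
      qed
    qed
    then have "(\<lambda>m. \<Prod>k\<in>K. g m (snd k) (\<omega> (fst k) - \<omega> w)) \<longlonglongrightarrow> (\<Prod>k\<in>K. 1)"
      by (rule tendsto_prod)
    then show ?thesis using True by (simp add: f_def D_def path_cylinder_def)
  next
    case False
    then have "f m \<omega> = 0" for m using f0[of m \<omega>] f1[of m \<omega>] by simp
    then show ?thesis using False by simp
  qed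
  have "(\<lambda>m. W.expectation (\<lambda>x. indicator D x - f m x)) \<longlonglongrightarrow> W.expectation (\<lambda>x. 0)"
  proof (rule integral_dominated_convergence[where w = "\<lambda>_. 1"])
    show "AE x in W. (\<lambda>m. indicator D x - f m x) \<longlonglongrightarrow> 0"
    proof (rule AE_I2)
      fix x
      have "(\<lambda>m. indicator D x - f m x) \<longlonglongrightarrow> indicator D x - indicator D x"
        by (intro tendsto_diff tendsto_const f_lim)
      then show "(\<lambda>m. indicator D x - f m x) \<longlonglongrightarrow> 0" by simp
    qed
    show "AE x in W. norm (indicator D x - f m x) \<le> 1" for m
    proof (rule AE_I2)
      fix x
      show "norm (indicator D x - f m x) \<le> 1" using f0[of m x] f1[of m x] by (cases "x \<in> D") auto
    qed
  qed auto
  then have small: "(\<lambda>m. W.expectation (\<lambda>x. indicator D x - f m x)) \<longlonglongrightarrow> 0" by simp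
  have flim: "(\<lambda>n. W.expectation (\<lambda>x. comp n x * f m x)) \<longlonglongrightarrow> 0" for m
  proof -
    have "(\<lambda>n. W.expectation (\<lambda>\<omega>. comp n \<omega> * (\<Prod>k\<in>K. g m (snd k) (\<omega> (fst k) - \<omega> w)))) \<longlonglongrightarrow> 0"
    proof (rule weak_limit_Lipschitz[OF K, where L = "real m"])
      fix c x y :: real
      have "\<bar>g m c x - g m c y\<bar> \<le> \<bar>real m * (c - x) - real m * (c - y)\<bar>" by (auto simp: g_def)
      also have "\<dots> = \<bar>real m * (y - x)\<bar>" by (simp add: algebra_simps)
      finally show "\<bar>g m c x - g m c y\<bar> \<le> real m * \<bar>x - y\<bar>" by (simp add: abs_mult abs_minus_commute)
    qed (use g01 in auto)
    moreover have "W.expectation (\<lambda>x. comp n x * f m x) =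
        W.expectation (\<lambda>\<omega>. comp n \<omega> * (\<Prod>k\<in>K. g m (snd k) (\<omega> (fst k) - \<omega> w)))" for n
      by (intro Bochner_Integration.integral_cong) (auto simp: f_def space_P)
    ultimately show ?thesis by simp
  qed
  fix e :: real assume "e > 0"
  then obtain m where "W.expectation (\<lambda>x. indicator D x - f m x) < e"
    using order_tendstoD(2)[OF small] by (auto simp: eventually_sequentially)
  then show "\<exists>f\<in>borel_measurable W. (\<forall>x. 0 \<le> f x \<and> f x \<le> indicator (path_cylinder w K) x) \<and>
      W.expectation (\<lambda>x. indicator (path_cylinder w K) x - f x) < e \<and> (\<lambda>n. W.expectation (\<lambda>x. comp n x * f x)) \<longlonglongrightarrow> 0"
    using f0 f1 flim fM unfolding D_def[symmetric] by blast
qed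

text \<open>Dynkin's theorem on the cylinder events. Complements use that \<open>comp n\<close> is
  centred; disjoint unions are approximated from below by finite ones, for which the limit holds by
  linearity.\<close>

lemma weak_limit_P:
  assumes "D \<in> sets P"
  shows "(\<lambda>n. W.expectation (\<lambda>x. comp n x * indicator D x)) \<longlonglongrightarrow> 0"
proof -
  have sP: "sets P = sigma_sets Omega0 {path_cylinder w K | K. finite K}"
    using sets_path_space[of w] sets_P by simp
  have closed: "{path_cylinder w K | K. finite K} \<subseteq> Pow Omega0" by (auto simp: path_cylinder_def)
  have "D \<in> sigma_sets Omega0 {path_cylinder w K | K. finite K}" using assms sP by simp
  with Int_stable_path_cylinder[of w] closed show ?thesis
  proof (induction rule: sigma_sets_induct_disjoint)
    case (basic A)
    then show ?case using weak_limit_cylinder by blast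
  next
    case (compl A)
    then have [measurable]: "A \<in> sets W" using sP by auto
    have "W.expectation (\<lambda>x. comp n x * indicator (Omega0 - A) x) = - W.expectation (\<lambda>x. comp n x * indicator A x)" for n
    proof -
      have "integrable W (comp n)" by (rule W.integrable_bounded[OF comp_W comp_bound])
      moreover have "integrable W (\<lambda>x. comp n x * indicator A x)"
        by (auto intro!: integrable_comp_mult simp: indicator_def)
      ultimately have "W.expectation (\<lambda>x. comp n x - comp n x * indicator A x) = - W.expectation (\<lambda>x. comp n x * indicator A x)"
        by (simp add: expectation_comp)
      moreover have "W.expectation (\<lambda>x. comp n x * indicator (Omega0 - A) x) = W.expectation (\<lambda>x. comp n x - comp n x * indicator A x)"
        by (intro Bochner_Integration.integral_cong) (auto simp: space_P indicator_def)
      ultimately show ?thesis by simp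
    qed
    then show ?case using tendsto_minus[OF compl(2)] by simp
  next
    case (union A)
    have A [measurable]: "A i \<in> sets W" for i using union(2) sP by auto
    show ?case
    proof (rule weak_limit_approx)
      fix e :: real assume e: "e > 0"
      have "range A \<subseteq> W.events" using A by blast
      from W.finite_measure_UNION[OF this union(1)]
      have "(\<lambda>k. \<Sum>i<k. W.prob (A i)) \<longlonglongrightarrow> W.prob (\<Union>i. A i)" by (simp add: sums_def)
      then obtain k where k: "W.prob (\<Union>i. A i) - e < (\<Sum>i<k. W.prob (A i))"
        using order_tendstoD(1)[of _ "W.prob (\<Union>i. A i)" sequentially "W.prob (\<Union>i. A i) - e"] e
        by (auto simp: eventually_sequentially)
      define f where "f = (\<lambda>x. \<Sum>i<k. indicator (A i) x :: real)"
      have f: "f x = indicator (\<Union>i<k. A i) x" for x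
        unfolding f_def using union(1) by (subst indicator_UN_disjoint) (auto simp: disjoint_family_on_def)
      have [measurable]: "f \<in> borel_measurable W" unfolding f_def by measurable
      have "W.expectation (\<lambda>x. indicator (\<Union>i. A i) x - f x) = W.prob (\<Union>i. A i) - (\<Sum>i<k. W.prob (A i))"
      proof -
        have "A i \<inter> space P = A i" "\<Union> (range A) \<inter> space P = \<Union> (range A)" for i
          using sets.Int_space_eq2[of _ W] by auto
        then show ?thesis
          unfolding f_def by (subst Bochner_Integration.integral_diff) (auto simp: less_top[symmetric])
      qed
      moreover have "(\<lambda>n. W.expectation (\<lambda>x. comp n x * f x)) \<longlonglongrightarrow> 0"
      proof -
        have "W.expectation (\<lambda>x. comp n x * f x) = (\<Sum>i<k. W.expectation (\<lambda>x. comp n x * indicator (A i) x))" for n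
          unfolding f_def sum_distrib_left
          by (rule Bochner_Integration.integral_sum) (auto intro!: integrable_comp_mult simp: indicator_def)
        then show ?thesis using tendsto_sum[of "{..<k}", OF union(3)] by simp
      qed
      moreover have "\<forall>x. 0 \<le> f x \<and> f x \<le> indicator (\<Union>i. A i) x"
        unfolding f by (auto simp: indicator_def)
      ultimately show "\<exists>f\<in>borel_measurable W. (\<forall>x. 0 \<le> f x \<and> f x \<le> indicator (\<Union>i. A i) x) \<and>
          W.expectation (\<lambda>x. indicator (\<Union>i. A i) x - f x) < e \<and> (\<lambda>n. W.expectation (\<lambda>x. comp n x * f x)) \<longlonglongrightarrow> 0"
        using k by (intro bexI[of _ f]) auto
    qed measurable
  qed simp
qed

lemma weak_limit:
  assumes D: "D \<in> sets W"
  shows "(\<lambda>n. W.expectation (\<lambda>x. comp n x * indicator D x)) \<longlonglongrightarrow> 0"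
proof -
  obtain Q N N' where Q: "D = Q \<union> N" "N \<subseteq> N'" "N' \<in> null_sets P" "Q \<in> sets P"
    using D by (rule sets_completionE)
  have [measurable]: "D \<in> sets W" "Q \<in> sets W" using D Q by auto
  have "AE x in P. x \<in> D \<longleftrightarrow> x \<in> Q"
    using AE_not_in[OF Q(3)] by eventually_elim (use Q in auto)
  from AE_completion[OF this]
  have "W.expectation (\<lambda>x. comp n x * indicator D x) = W.expectation (\<lambda>x. comp n x * indicator Q x)" for n
    by (intro integral_cong_AE) (auto simp: indicator_def elim!: eventually_mono)
  then show ?thesis using weak_limit_P[OF Q(4)] by simp
qed

end

section \<open>Stopping times avoid honestly indexed sets\<close>

lemma
  fixes f :: "nat \<Rightarrow> 'a :: linorder"
  assumes "\<And>j. f j \<le> f (Suc j)"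
  shows UN_Ioc_chain: "(\<Union>j<n. {f j<..f (Suc j)}) = {f 0<..f n}"
    and disjoint_Ioc_chain: "disjoint_family (\<lambda>j. {f j<..f (Suc j)})"
proof -
  have mono: "i \<le> j \<Longrightarrow> f i \<le> f j" for i j by (rule lift_Suc_mono_le[of f]) (use assms in auto)
  show "(\<Union>j<n. {f j<..f (Suc j)}) = {f 0<..f n}"
  proof (induction n)
    case (Suc n)
    have "(\<Union>j<Suc n. {f j<..f (Suc j)}) = {f 0<..f n} \<union> {f n<..f (Suc n)}"
      unfolding lessThan_Suc using Suc by auto
    also have "\<dots> = {f 0<..f (Suc n)}" using mono[of 0 n] assms[of n] by (intro ivl_disj_un_two) auto
    finally show ?case .
  qed simp
  have "False" if "x \<in> {f i<..f (Suc i)}" "x \<in> {f j<..f (Suc j)}" "i < j" for x i j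
    using that mono[of "Suc i" j] by auto
  then show "disjoint_family (\<lambda>j. {f j<..f (Suc j)})"
    unfolding disjoint_family_on_def by (metis disjoint_iff linorder_neqE_nat)
qed

lemma disjoint_family_preimage:
  "disjoint_family X \<Longrightarrow> disjoint_family (\<lambda>j. {x \<in> A. g x \<in> X j})"
  by (auto simp: disjoint_family_on_def)

context two_sided_wiener
begin

lemma expectation_mult_indep:
  assumes q: "q \<in> borel_measurable (incr_field W (-\<infinity>) (ereal u))" "\<And>x. 0 \<le> q x" "\<And>x. q x \<le> (1 :: real)"
    and B: "B \<in> sets (incr_field W (ereal u) \<infinity>)"
  shows "W.expectation (\<lambda>x. q x * indicator B x) = W.expectation q * W.prob B"
proof -
  have BW [measurable]: "B \<in> sets W" using B subalgebra_incr_field by (auto simp: subalgebra_def)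
  note [measurable] = measurable_from_subalg[OF subalgebra_incr_field q(1)]
  \<comment> \<open>The unit component is a dummy: \<open>expectation_freeze\<close> is applied with
    a constant \<open>U\<close>.\<close>
  have "W.expectation (\<lambda>x. q x * snd ((), indicator B x)) =
      W.expectation (\<lambda>x. q x * W.expectation (\<lambda>y. snd ((), indicator B y)))"
  proof (rule W.expectation_freeze[OF subalgebra_incr_field, where N = borel and L = "count_space UNIV"])
    fix A and C :: "real set" assume A: "A \<in> sets (incr_field W (-\<infinity>) (ereal u))" and C: "C \<in> sets borel"
    have "indicator B \<in> borel_measurable (incr_field W (ereal u) \<infinity>)" using B by simp
    from measurable_sets[OF this C] A
    show "W.prob (A \<inter> (indicator B -` C \<inter> space W)) = W.prob A * W.prob (indicator B -` C \<inter> space W)"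
      by (intro indep_past_future) auto
  next
    show "integrable W (\<lambda>x. q x * snd ((), indicator B x))"
      by (rule W.integrable_bounded[where C = 1]) (use q in \<open>auto simp: indicator_def\<close>)
  qed (use q in auto)
  moreover have "B \<inter> space P = B" using sets.Int_space_eq2[OF BW] by simp
  ultimately show ?thesis by simp
qed

text \<open>This fails in filtrations with totally inaccessible times, such as the first large jump of a
  Levy process: the hypothesis only bounds the conditional probability of \<open>D\<close> and \<open>u < S \<le> w'\<close>
  given the past of \<open>u\<close>, while the conclusion bounds that of \<open>D\<close> given that \<open>S\<close> lies in \<open>(w, w']\<close>.\<close>

lemma stopping_time_bound:
  assumes ww: "w < w'" and S: "stopping_time_incr W S" and D: "D \<in> sets W"
    and bound: "\<And>u. w \<le> u \<Longrightarrow> u < w' \<Longrightarrow> \<exists>B\<in>sets (incr_field W (ereal u) \<infinity>). W.prob B \<le> \<rho> \<and>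
      (AE \<omega> in W. \<omega> \<in> D \<longrightarrow> ereal u < S \<omega> \<longrightarrow> S \<omega> \<le> ereal w' \<longrightarrow> \<omega> \<in> B)"
  shows "W.prob {\<omega> \<in> D. S \<omega> \<in> {ereal w<..ereal w'}} \<le> \<rho> * W.prob {\<omega> \<in> space W. S \<omega> \<in> {ereal w<..ereal w'}}"
proof -
  define v where "v = grid w w'"
  define F where "F = (\<lambda>n j. incr_field W (-\<infinity>) (ereal (v n j)))"
  have v_mono: "v n j \<le> v n (Suc j)" for n j using ww by (simp add: v_def grid_def field_simps divide_right_mono)
  have v0: "v n 0 = w" for n by (simp add: v_def grid_def)
  have vn: "v n n = w'" if "n > 0" for n using that by (simp add: v_def grid_def)
  have v_le: "w \<le> v n j" for n j using ww by (simp add: v_def grid_def)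
  have v_less: "v n j < w'" if "j < n" for n j
    using that ww mult_strict_right_mono[of "real j" "real n" "w' - w"] by (simp add: v_def grid_def field_simps)
  define E where "E = (\<lambda>n j. {\<omega> \<in> space W. S \<omega> \<in> {ereal (v n j)<..ereal (v n (Suc j))}})"
  define G where "G = (\<lambda>n j. {\<omega> \<in> space W. ereal (v n j) < S \<omega>})"
  have le: "{\<omega> \<in> space W. S \<omega> \<le> ereal a} \<in> sets (incr_field W (-\<infinity>) (ereal a))" for a
    using S unfolding stopping_time_incr_def by blast
  have G: "G n j \<in> sets (F n j)" for n j
  proof -
    have "G n j = space (F n j) - {\<omega> \<in> space W. S \<omega> \<le> ereal (v n j)}" by (auto simp: G_def F_def)
    also have "\<dots> \<in> sets (F n j)" using le[of "v n j"] unfolding F_def by (rule sets.compl_sets)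
    finally show ?thesis .
  qed
  have sub: "subalgebra W (F n j)" for n j unfolding F_def by (rule subalgebra_incr_field)
  have sub2: "subalgebra (F n (Suc j)) (F n j)" for n j
    unfolding F_def using v_mono by (intro subalgebra_incr_field_mono) auto
  have E: "E n j \<in> sets (F n (Suc j))" for n j
  proof -
    have "E n j = G n j \<inter> {\<omega> \<in> space W. S \<omega> \<le> ereal (v n (Suc j))}" by (auto simp: E_def G_def)
    moreover have "G n j \<in> sets (F n (Suc j))"
      using sub2[of n j] G[of n j] unfolding subalgebra_def by blast
    ultimately show ?thesis using le[of "v n (Suc j)"] by (simp add: F_def)
  qed
  have EW [measurable]: "E n j \<in> sets W" for n j
    using E[of n j] sub[of n "Suc j"] unfolding subalgebra_def by blast
  have EG: "E n j \<subseteq> G n j" for n j by (auto simp: E_def G_def)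
  \<comment> \<open>Bundles all properties of one version, so that a single choice over
    \<open>n\<close> and \<open>j\<close> provides the whole family.\<close>
  define Q where "Q = (\<lambda>n j (q :: (real \<Rightarrow> real) \<Rightarrow> real). q \<in> borel_measurable (F n j) \<and> (\<forall>x. 0 \<le> q x \<and> q x \<le> 1) \<and>
      (\<forall>x. x \<notin> G n j \<longrightarrow> q x = 0) \<and>
      (\<forall>f C. f \<in> borel_measurable (F n j) \<longrightarrow> (\<forall>x. \<bar>f x\<bar> \<le> C) \<longrightarrow>
        W.expectation (\<lambda>x. q x * f x) = W.expectation (\<lambda>x. indicator (E n j) x * f x)))"
  have "\<exists>q. Q n j q" for n j
    unfolding Q_def by (rule W.cond_prob_version[OF sub EW[of n j] G[of n j] EG]) blast
  then have "Q n j (SOME q. Q n j q)" for n j by (rule someI_ex)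
  then have "\<exists>p. \<forall>n j. Q n j (p n j)" by (intro exI[of _ "\<lambda>n j. SOME q. Q n j q"]) simp
  then obtain p where pQ: "\<And>n j. Q n j (p n j)" by blast
  then have p: "\<And>n j. p n j \<in> borel_measurable (F n j)" "\<And>n j x. 0 \<le> p n j x" "\<And>n j x. p n j x \<le> 1"
      and pG: "\<And>n j x. x \<notin> G n j \<Longrightarrow> p n j x = 0"
      and cond: "\<And>n j f C. f \<in> borel_measurable (F n j) \<Longrightarrow> (\<And>x. \<bar>f x\<bar> \<le> C) \<Longrightarrow>
        W.expectation (\<lambda>x. p n j x * f x) = W.expectation (\<lambda>x. indicator (E n j) x * f x)"
    unfolding Q_def by blast+
  have disj: "disjoint_family (E n)" for n
    unfolding E_def
    by (rule disjoint_family_preimage[OF disjoint_Ioc_chain[of "\<lambda>j. ereal (v n j)"]]) (simp add: v_mono)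
  interpret C: compensated_indicators P w w' E p
  proof
    show "W.expectation (\<lambda>x. p n j x * f x) = W.expectation (\<lambda>x. indicator (E n j) x * f x)"
      if "f \<in> borel_measurable (incr_field W (-\<infinity>) (ereal (grid w w' n j)))" "\<And>x. \<bar>f x\<bar> \<le> C" for n j f C
      using that by (intro cond[of f n j C]) (simp_all add: F_def v_def)
  qed (fact ww disj p(2,3) E[unfolded F_def v_def] p(1)[unfolded F_def v_def])+
  define I where "I = {\<omega> \<in> space W. S \<omega> \<in> {ereal w<..ereal w'}}"
  have I: "I = (\<Union>j<n. E n j)" if "n > 0" for n
  proof -
    have "(\<Union>j<n. {ereal (v n j)<..ereal (v n (Suc j))}) = {ereal w<..ereal w'}"
      using UN_Ioc_chain[of "\<lambda>j. ereal (v n j)" n] v_mono[of n] by (simp add: v0 vn[OF that])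
    then show ?thesis unfolding I_def E_def by blast
  qed
  have IW [measurable]: "I \<in> sets W" using I[of 1] by simp
  define D' where "D' = D \<inter> I"
  have D' [measurable]: "D' \<in> sets W" unfolding D'_def using D by simp
  have prob_I: "(\<Sum>j<n. W.prob (E n j)) = W.prob I" if "n > 0" for n
    unfolding I[OF that] by (rule W.finite_measure_finite_Union[symmetric])
      (use disj[of n] in \<open>auto simp: disjoint_family_on_def\<close>)
  \<comment> \<open>Here \<open>p n j\<close> vanishes unless \<open>S\<close> lies beyond the left
    end of the cell, and on \<open>D'\<close> this places the path almost surely in
    \<open>B\<close>. As \<open>B\<close> is independent of that past, the expectation
    factorizes.\<close>
  have drift: "W.expectation (\<lambda>x. p n j x * indicator D' x) \<le> \<rho> * W.prob (E n j)" if jn: "j < n" for n j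
  proof -
    obtain B where B: "B \<in> sets (incr_field W (ereal (v n j)) \<infinity>)" "W.prob B \<le> \<rho>"
      and AE: "AE \<omega> in W. \<omega> \<in> D \<longrightarrow> ereal (v n j) < S \<omega> \<longrightarrow> S \<omega> \<le> ereal w' \<longrightarrow> \<omega> \<in> B"
      using bound[OF v_le v_less[OF jn]] by blast
    have [measurable]: "B \<in> sets W" using B subalgebra_incr_field by (auto simp: subalgebra_def)
    have pW [measurable]: "p n j \<in> borel_measurable W" by (rule measurable_from_subalg[OF sub p(1)])
    have int: "integrable W (\<lambda>x. p n j x * indicator Q x)" if "Q \<in> sets W" for Q
      using that p by (intro W.integrable_bounded[where C = 1]) (auto simp: indicator_def)
    have "W.expectation (\<lambda>x. p n j x * indicator D' x) \<le> W.expectation (\<lambda>x. p n j x * indicator B x)"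
    proof (rule integral_mono_AE)
      show "AE x in W. p n j x * indicator D' x \<le> p n j x * indicator B x"
        using AE
      proof eventually_elim
        case (elim x)
        then show ?case using pG[of x n j] p(2)[of n j x]
          by (cases "x \<in> G n j") (auto simp: indicator_def D'_def I_def G_def)
      qed
    qed (auto intro!: int)
    also have "\<dots> = W.expectation (p n j) * W.prob B"
      using p B(1) by (intro expectation_mult_indep[where u = "v n j"]) (auto simp: F_def)
    also have "W.expectation (p n j) = W.prob (E n j)" by (rule C.expectation_p)
    also have "W.prob (E n j) * W.prob B \<le> W.prob (E n j) * \<rho>" using B(2) by (intro mult_left_mono) auto
    finally show ?thesis by (simp add: mult.commute)
  qed
  \<comment> \<open>The events \<open>E n j\<close> partition the window, so the indicator part
    returns the whole probability of \<open>D'\<close>. The left side does not depend on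
    \<open>n\<close>, and the right side tends to 0.\<close>
  have key: "W.prob D' - \<rho> * W.prob I \<le> W.expectation (\<lambda>x. C.comp n x * indicator D' x)" if n: "n > 0" for n
  proof -
    have int: "integrable W (\<lambda>x. indicator (E n j) x * indicator D' x :: real)" "integrable W (\<lambda>x. p n j x * indicator D' x)" for j
      using p C.p_W by (auto intro!: W.integrable_bounded[where C = 1] simp: indicator_def)
    have "W.expectation (\<lambda>x. C.comp n x * indicator D' x) =
        W.expectation (\<lambda>x. \<Sum>j<n. indicator (E n j) x * indicator D' x - p n j x * indicator D' x)"
      unfolding C.comp_def sum_distrib_right left_diff_distrib ..
    also have "\<dots> = (\<Sum>j<n. W.expectation (\<lambda>x. indicator (E n j) x * indicator D' x) - W.expectation (\<lambda>x. p n j x * indicator D' x))"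
      using int by simp
    also have "\<dots> = (\<Sum>j<n. W.expectation (\<lambda>x. indicator (E n j) x * indicator D' x)) - (\<Sum>j<n. W.expectation (\<lambda>x. p n j x * indicator D' x))"
      by (rule sum_subtractf)
    also have "(\<Sum>j<n. W.expectation (\<lambda>x. indicator (E n j) x * indicator D' x)) = (\<Sum>j<n. W.prob (E n j \<inter> D'))"
    proof (rule sum.cong[OF refl])
      fix j
      have "E n j \<inter> D' \<inter> space W = E n j \<inter> D'" by (rule sets.Int_space_eq2) simp
      then show "W.expectation (\<lambda>x. indicator (E n j) x * indicator D' x) = W.prob (E n j \<inter> D')"
        unfolding indicator_inter_arith[symmetric] by simp
    qed
    also have "\<dots> = W.prob (\<Union>j<n. E n j \<inter> D')"
      by (rule W.finite_measure_finite_Union[symmetric])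
        (use disj[of n] in \<open>auto simp: disjoint_family_on_def\<close>)
    also have "(\<Union>j<n. E n j \<inter> D') = D'" using I[OF n] by (auto simp: D'_def)
    finally have "W.expectation (\<lambda>x. C.comp n x * indicator D' x) =
        W.prob D' - (\<Sum>j<n. W.expectation (\<lambda>x. p n j x * indicator D' x))" .
    moreover have "(\<Sum>j<n. W.expectation (\<lambda>x. p n j x * indicator D' x)) \<le> (\<Sum>j<n. \<rho> * W.prob (E n j))"
      by (rule sum_mono) (use drift in auto)
    moreover have "\<dots> = \<rho> * W.prob I" by (simp add: sum_distrib_left[symmetric] prob_I[OF n])
    ultimately show ?thesis by linarith
  qed
  have "W.prob D' - \<rho> * W.prob I \<le> 0"
    by (rule LIMSEQ_le_const[OF C.weak_limit[OF D']]) (use key in \<open>auto intro!: exI[of _ 1]\<close>)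
  moreover have "D' = {\<omega> \<in> D. S \<omega> \<in> {ereal w<..ereal w'}}"
    using sets.sets_into_space[OF D] by (auto simp: D'_def I_def)
  ultimately show ?thesis by (simp add: I_def)
qed

section \<open>Hits of a single indexed time\<close>

lemma stopping_time_measurable:
  assumes "stopping_time_incr W S"
  shows "S \<in> borel_measurable W"
proof -
  have le: "{\<omega> \<in> space W. S \<omega> \<le> ereal a} \<in> sets W" for a
    using assms subalgebra_incr_field unfolding stopping_time_incr_def subalgebra_def by blast
  show ?thesis
  proof (rule borel_measurableI_le)
    fix y :: ereal
    show "{\<omega> \<in> space W. S \<omega> \<le> y} \<in> sets W"
    proof (cases y)
      case MInf
      have "x = -\<infinity>" if "\<forall>n :: nat. x \<le> ereal (- real n)" for x :: ereal
      proof (cases x)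
        case (real r)
        obtain n :: nat where "- r < real n" using reals_Archimedean2 by blast
        with that real show ?thesis by (auto dest: spec[of _ n])
      qed (use that[rule_format, of 0] in auto)
      then have "{\<omega> \<in> space W. S \<omega> \<le> y} = (\<Inter>n :: nat. {\<omega> \<in> space W. S \<omega> \<le> ereal (- real n)})"
        using MInf by auto
      also have "\<dots> \<in> sets W" using le by (intro sets.countable_INT) auto
      finally show ?thesis .
    qed (use le sets.top[of W] in auto)
  qed
qed

lemma dagger_borel_sets:
  "B \<in> sets borel \<Longrightarrow> Some ` B \<in> sets dagger_borel" "{None} \<in> sets dagger_borel"
  "space dagger_borel = UNIV"
  unfolding dagger_borel_def by (auto intro!: in_measure_of simp: space_measure_of_conv)

text \<open>Before \<open>a - \<gamma>\<close>, a hit \<open>S = \<tau> b a\<close> with \<open>u < S \<le> u + \<epsilon>\<close> forces \<open>\<tau> u (u + \<gamma>)\<close> to lie within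
  \<open>\<epsilon>\<close> of \<open>u\<close>; this event depends on the path after \<open>u\<close> only and its probability does not depend on \<open>u\<close>.\<close>

lemma honest_indexation_avoided:
  assumes honest: "honest_indexation W M \<tau>" and S: "stopping_time_incr W S" and ba: "b < a"
  shows "AE \<omega> in W. \<forall>x. \<tau> b a \<omega> = Some x \<longrightarrow> S \<omega> \<noteq> ereal x"
proof -
  have loc: "AE \<omega> in W. \<tau> s t \<omega> \<in> Some ` {s<..<t}"
      "\<tau> s t \<in> incr_field W (ereal s) (ereal t) \<rightarrow>\<^sub>M dagger_borel" if "s < t" for s t
    using honest that unfolding honest_indexation_def by blast+
  have stat: "AE \<omega> in W. \<tau> (s + h) (t + h) \<omega> = map_option (\<lambda>x. h + x) (\<tau> s t (levy_shift h \<omega>))"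
    if "s < t" for h s t
    using honest that unfolding honest_indexation_def by blast
  have nest: "AE \<omega> in W. \<tau> s t \<omega> \<in> Some ` {u<..<v} \<longrightarrow> \<tau> s t \<omega> = \<tau> u v \<omega>"
    if "s \<le> u" "u < v" "v \<le> t" for s u v t
    using honest that unfolding honest_indexation_def by blast
  have tauW: "{\<omega> \<in> space W. \<tau> s t \<omega> \<in> Some ` B} \<in> sets (incr_field W (ereal s) (ereal t))"
    if "s < t" "B \<in> sets borel" for s t B
    using measurable_sets[OF loc(2)[OF that(1)] dagger_borel_sets(1)[OF that(2)]]
    by (simp add: vimage_def Int_def conj_commute)
  have SW [measurable]: "S \<in> borel_measurable W" by (rule stopping_time_measurable[OF S])
  \<comment> \<open>A real-valued substitute that makes the hitting event measurable. The default 0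
    matters only on a null set, since locality excludes the coffin state almost surely.\<close>
  define T where "T = (\<lambda>\<omega>. case \<tau> b a \<omega> of None \<Rightarrow> 0 | Some x \<Rightarrow> x)"
  have "(\<lambda>z. case z of None \<Rightarrow> 0 | Some x \<Rightarrow> x) \<in> measurable dagger_borel (borel :: real measure)"
  proof (rule measurableI)
    fix B :: "real set" assume B: "B \<in> sets borel"
    have "(\<lambda>z. case z of None \<Rightarrow> 0 | Some x \<Rightarrow> x) -` B = Some ` B \<union> (if 0 \<in> B then {None} else {})"
      by (auto split: option.splits)
    then show "(\<lambda>z. case z of None \<Rightarrow> 0 | Some x \<Rightarrow> x) -` B \<inter> space dagger_borel \<in> sets dagger_borel"
      using sets.insert_in_sets[OF dagger_borel_sets(2) dagger_borel_sets(1)[OF B]]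
        dagger_borel_sets(1)[OF B] by (simp add: dagger_borel_sets(3))
  qed simp
  then have TW [measurable]: "T \<in> borel_measurable W"
    unfolding T_def
    by (rule measurable_compose[OF measurable_from_subalg[OF subalgebra_incr_field loc(2)[OF ba]]])
  define D where "D = {\<omega> \<in> space W. S \<omega> = ereal (T \<omega>)}"
  have D [measurable]: "D \<in> sets W" unfolding D_def by measurable
  \<comment> \<open>Staying \<gamma> away from \<open>a\<close> keeps the interval from
    \<open>u\<close> to \<open>u + \<gamma>\<close> inside that from \<open>b\<close> to
    \<open>a\<close> for every time \<open>u\<close> of the windows, as nestedness requires.\<close>
  have null: "W.prob {\<omega> \<in> D. S \<omega> \<in> {ereal b<..ereal (a - \<gamma>)}} = 0" if \<gamma>: "0 < \<gamma>" "\<gamma> < a - b" for \<gamma>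
  proof -
    define l where "l = a - \<gamma> - b"
    have l: "l > 0" using \<gamma> by (simp add: l_def)
    \<comment> \<open>The event at time 0 whose probability serves as \<rho> for every
      \<open>u\<close>. These events decrease to the empty set as \<open>e\<close> tends to 0,
      because an element of every one would need a positive value below every positive
      bound.\<close>
    define C where "C = (\<lambda>e. {\<omega> \<in> space W. \<tau> 0 \<gamma> \<omega> \<in> Some ` {0<..e}})"
    have CW [measurable]: "C e \<in> sets W" for e
      using tauW[OF \<gamma>(1), of "{0<..e}"] subalgebra_incr_field by (auto simp: C_def subalgebra_def)
    have bound: "W.prob {\<omega> \<in> D. S \<omega> \<in> {ereal b<..ereal (a - \<gamma>)}} \<le> W.prob (C (l / real m))"
      if m: "m > 0" "l / real m < \<gamma>" for m
    proof -
      \<comment> \<open>The window length. Being less than \<gamma>, it puts a value in the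
        half-open interval from \<open>u\<close> to \<open>u + e\<close> strictly inside the
        interval to which nestedness applies.\<close>
      define e where "e = l / real m"
      have e: "e > 0" "e < \<gamma>" using m l by (auto simp: e_def)
      define f where "f = (\<lambda>i. b + real i * e)"
      have f_mono: "ereal (f i) \<le> ereal (f (Suc i))" for i using e by (simp add: f_def algebra_simps)
      have f0: "f 0 = b" by (simp add: f_def)
      have fm: "f m = a - \<gamma>" using m by (simp add: f_def e_def l_def)
      define I where "I = (\<lambda>i. {\<omega> \<in> space W. S \<omega> \<in> {ereal (f i)<..ereal (f (Suc i))}})"
      have IW [measurable]: "I i \<in> sets W" for i unfolding I_def by measurable
      have disj: "disjoint_family I"
        unfolding I_def
        by (rule disjoint_family_preimage[OF disjoint_Ioc_chain[of "\<lambda>i. ereal (f i)"]]) (rule f_mono)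
      have part: "W.prob {\<omega> \<in> D. S \<omega> \<in> {ereal (f i)<..ereal (f (Suc i))}} \<le> W.prob (C e) * W.prob (I i)"
        if i: "i < m" for i
        unfolding I_def
      proof (rule stopping_time_bound[OF _ S D])
        show "f i < f (Suc i)" using e by (simp add: f_def algebra_simps)
        fix u assume u: "f i \<le> u" "u < f (Suc i)"
        have "b \<le> u" using u(1) e by (simp add: f_def) (smt (verit) mult_nonneg_nonneg of_nat_0_le_iff)
        have "real (Suc i) * e \<le> real m * e" using i e by (intro mult_right_mono) auto
        then have "f (Suc i) \<le> a - \<gamma>" unfolding fm[symmetric] by (simp add: f_def)
        then have "u + \<gamma> \<le> a" using u(2) by simp
        have fe: "f (Suc i) \<le> u + e" using u(1) by (simp add: f_def algebra_simps)
        define B where "B = {\<omega> \<in> space W. \<tau> u (u + \<gamma>) \<omega> \<in> Some ` {u<..u + e}}"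
        have B: "B \<in> sets (incr_field W (ereal u) \<infinity>)"
          using tauW[of u "u + \<gamma>" "{u<..u + e}"] \<gamma>(1) subalgebra_incr_field_mono[of "ereal u" "ereal u" "ereal (u + \<gamma>)" \<infinity>]
          unfolding B_def subalgebra_def by auto
        have "W.prob B = W.prob (C e)"
        proof (rule prob_levy_shift_W[where v = u])
          show "B \<in> sets W" using B subalgebra_incr_field by (auto simp: subalgebra_def)
          have shift: "levy_shift u \<omega> \<in> space W" if "\<omega> \<in> space W" for \<omega>
            using levy_shift_in_Omega0 that by (simp add: space_P)
          show "AE \<omega> in W. \<omega> \<in> B \<longleftrightarrow> levy_shift u \<omega> \<in> C e"
            using stat[OF \<gamma>(1), of u] AE_space[of W]
            by eventually_elim (use shift in \<open>auto simp: B_def C_def image_iff add.commute\<close>)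
        qed simp
        moreover have "AE \<omega> in W. \<omega> \<in> D \<longrightarrow> ereal u < S \<omega> \<longrightarrow> S \<omega> \<le> ereal (f (Suc i)) \<longrightarrow> \<omega> \<in> B"
        proof -
          have "AE \<omega> in W. \<tau> b a \<omega> \<in> Some ` {u<..<u + \<gamma>} \<longrightarrow> \<tau> b a \<omega> = \<tau> u (u + \<gamma>) \<omega>"
            using \<gamma>(1) \<open>b \<le> u\<close> \<open>u + \<gamma> \<le> a\<close> by (intro nest) auto
          with loc(1)[OF ba] AE_space[of W] show ?thesis
          proof eventually_elim
            case (elim \<omega>)
            then obtain x where x: "\<tau> b a \<omega> = Some x" by auto
            show ?case
            proof (intro impI)
              assume "\<omega> \<in> D" "ereal u < S \<omega>" "S \<omega> \<le> ereal (f (Suc i))"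
              then have "u < x" "x \<le> u + e" using fe by (auto simp: D_def T_def x)
              then show "\<omega> \<in> B" using elim e by (auto simp: B_def x)
            qed
          qed
        qed
        ultimately show "\<exists>B\<in>sets (incr_field W (ereal u) \<infinity>). W.prob B \<le> W.prob (C e) \<and>
            (AE \<omega> in W. \<omega> \<in> D \<longrightarrow> ereal u < S \<omega> \<longrightarrow> S \<omega> \<le> ereal (f (Suc i)) \<longrightarrow> \<omega> \<in> B)"
          using B by (intro bexI[of _ B]) auto
      qed
      have "{\<omega> \<in> D. S \<omega> \<in> {ereal b<..ereal (a - \<gamma>)}} = (\<Union>i<m. {\<omega> \<in> D. S \<omega> \<in> {ereal (f i)<..ereal (f (Suc i))}})"
        using UN_Ioc_chain[of "\<lambda>i. ereal (f i)" m, OF f_mono] unfolding f0 fm by blast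
      also have "W.prob \<dots> \<le> (\<Sum>i<m. W.prob {\<omega> \<in> D. S \<omega> \<in> {ereal (f i)<..ereal (f (Suc i))}})"
      proof (rule W.finite_measure_subadditive_finite)
        have "{\<omega> \<in> D. S \<omega> \<in> {ereal (f i)<..ereal (f (Suc i))}} = D \<inter> I i" for i
          by (auto simp: D_def I_def)
        then show "(\<lambda>i. {\<omega> \<in> D. S \<omega> \<in> {ereal (f i)<..ereal (f (Suc i))}}) ` {..<m} \<subseteq> W.events" by auto
      qed simp
      \<comment> \<open>The factors \<open>W.prob (I i)\<close> belong to disjoint events, so the
        sum costs no factor \<open>m\<close>. The bound \<open>W.prob (C e)\<close> alone for each
        window would not suffice.\<close>
      also have "\<dots> \<le> (\<Sum>i<m. W.prob (C e) * W.prob (I i))" by (rule sum_mono) (use part in auto)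
      also have "\<dots> = W.prob (C e) * W.prob (\<Union>i<m. I i)"
        unfolding sum_distrib_left[symmetric]
        by (subst W.finite_measure_finite_Union) (use disj in \<open>auto simp: disjoint_family_on_def\<close>)
      also have "\<dots> \<le> W.prob (C e) * 1" by (intro mult_left_mono) auto
      finally show ?thesis by (simp add: e_def)
    qed
    have "(\<lambda>m. W.prob (C (l / real (Suc m)))) \<longlonglongrightarrow> W.prob (\<Inter>m. C (l / real (Suc m)))"
    proof (rule W.finite_Lim_measure_decseq)
      show "decseq (\<lambda>m. C (l / real (Suc m)))"
      proof (rule decseq_SucI)
        fix m
        have "l / real (Suc (Suc m)) \<le> l / real (Suc m)" using l by (intro divide_left_mono) auto
        then show "C (l / real (Suc (Suc m))) \<subseteq> C (l / real (Suc m))" by (auto simp: C_def)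
      qed
    qed auto
    moreover have "(\<Inter>m. C (l / real (Suc m))) = {}"
    proof (rule ccontr)
      assume "(\<Inter>m. C (l / real (Suc m))) \<noteq> {}"
      then obtain \<omega> where \<omega>: "\<And>m. \<omega> \<in> C (l / real (Suc m))" by auto
      then obtain x where x: "\<tau> 0 \<gamma> \<omega> = Some x" "x > 0" using \<omega>[of 0] by (auto simp: C_def)
      obtain m where "l / x < real m" using reals_Archimedean2 by blast
      then have "l < x * real (Suc m)" using x by (simp add: pos_divide_less_eq algebra_simps)
      moreover have "x \<le> l / real (Suc m)" using \<omega>[of m] x by (auto simp: C_def)
      ultimately show False by (simp add: pos_le_divide_eq)
    qed
    ultimately have lim: "(\<lambda>m. W.prob (C (l / real (Suc m)))) \<longlonglongrightarrow> 0" by simp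
    obtain N where N: "l / \<gamma> < real N" using reals_Archimedean2 by blast
    have "W.prob {\<omega> \<in> D. S \<omega> \<in> {ereal b<..ereal (a - \<gamma>)}} \<le> 0"
    proof (rule LIMSEQ_le_const[OF lim], intro exI[of _ N] allI impI)
      fix m assume "N \<le> m"
      then have "l / \<gamma> < real (Suc m)" using N by linarith
      then have "l / real (Suc m) < \<gamma>" using \<gamma>(1) by (simp add: pos_divide_less_eq mult.commute)
      then show "W.prob {\<omega> \<in> D. S \<omega> \<in> {ereal b<..ereal (a - \<gamma>)}} \<le> W.prob (C (l / real (Suc m)))"
        by (rule bound[rotated]) simp
    qed
    then show ?thesis by (simp add: antisym)
  qed
  have "AE \<omega> in W. \<omega> \<notin> {\<omega> \<in> D. S \<omega> \<in> {ereal b<..ereal (a - (a - b) / real (k + 2))}}" for k :: nat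
  proof -
    \<comment> \<open>The shift by 2 makes \<gamma> strictly less than \<open>a - b\<close> already
      for \<open>k = 0\<close>; as \<open>k\<close> grows the excluded margin at \<open>a\<close>
      shrinks to nothing.\<close>
    define \<gamma> where "\<gamma> = (a - b) / real (k + 2)"
    have \<gamma>: "0 < \<gamma>" "\<gamma> < a - b" using ba divide_strict_left_mono[of 1 "real (k + 2)" "a - b"] by (auto simp: \<gamma>_def)
    have "{\<omega> \<in> D. S \<omega> \<in> {ereal b<..ereal (a - \<gamma>)}} = {\<omega> \<in> space W. \<omega> \<in> D \<and> S \<omega> \<in> {ereal b<..ereal (a - \<gamma>)}}"
      by (auto simp: D_def)
    moreover have "\<dots> \<in> sets W" by measurable
    ultimately have "{\<omega> \<in> D. S \<omega> \<in> {ereal b<..ereal (a - \<gamma>)}} \<in> sets W" by metis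
    from W.prob_eq_0[OF this] null[OF \<gamma>] show ?thesis unfolding \<gamma>_def by blast
  qed
  then have "AE \<omega> in W. \<forall>k. \<omega> \<notin> {\<omega> \<in> D. S \<omega> \<in> {ereal b<..ereal (a - (a - b) / real (k + 2))}}"
    unfolding AE_all_countable by blast
  with loc(1)[OF ba] AE_space[of W] show ?thesis
  proof eventually_elim
    case (elim \<omega>)
    show ?case
    proof (intro allI impI notI)
      fix x assume x: "\<tau> b a \<omega> = Some x" and Sx: "S \<omega> = ereal x"
      have bx: "b < x" "x < a" using elim x by auto
      obtain k where "(a - b) / (a - x) < real k" using reals_Archimedean2 by blast
      then have "(a - b) / (a - x) < real (k + 2)" by simp
      then have "(a - b) / real (k + 2) < a - x" using bx by (simp add: pos_divide_less_eq mult.commute)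
      moreover have "\<omega> \<in> D" using elim x Sx by (simp add: D_def T_def)
      ultimately show False using elim(3)[rule_format, of k] bx Sx by auto
    qed
  qed
qed

end

theorem theorem5p9:
  fixes W :: "(real \<Rightarrow> real) measure"
    and M :: "(real \<Rightarrow> real) \<Rightarrow> real set"
    and \<tau> :: "real \<Rightarrow> real \<Rightarrow> (real \<Rightarrow> real) \<Rightarrow> real option"
    and S :: "(real \<Rightarrow> real) \<Rightarrow> ereal"
  assumes "two_sided_wiener_measure W"
    and "honest_indexation W M \<tau>"
    and "stopping_time_incr W S"
  shows "{\<omega> \<in> space W. S \<omega> \<in> ereal ` M \<omega>} \<in> sets W \<and>
         measure W {\<omega> \<in> space W. S \<omega> \<in> ereal ` M \<omega>} = 0"
proof -
  obtain P where P: "two_sided_wiener P" and W: "W = completion P"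
    using assms(1) unfolding two_sided_wiener_measure_def two_sided_wiener_def by auto
  interpret two_sided_wiener P by (fact P)
  \<comment> \<open>By exhaustion the random set consists almost surely of the values at rational
    pairs, so countably many null sets suffice.\<close>
  have "AE \<omega> in W. s < t \<longrightarrow> (\<forall>x. \<tau> s t \<omega> = Some x \<longrightarrow> S \<omega> \<noteq> ereal x)" for s t
    using honest_indexation_avoided assms(2,3) unfolding W by (cases "s < t") auto
  then have "AE \<omega> in W. \<forall>s\<in>\<rat>. \<forall>t\<in>\<rat>. s < t \<longrightarrow> (\<forall>x. \<tau> s t \<omega> = Some x \<longrightarrow> S \<omega> \<noteq> ereal x)"
    by (simp add: AE_ball_countable countable_rat)
  moreover have "AE \<omega> in W. Some ` M \<omega> = {\<tau> s t \<omega> | s t. s \<in> \<rat> \<and> t \<in> \<rat> \<and> s < t}"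
    using assms(2) unfolding honest_indexation_def by blast
  ultimately have "AE \<omega> in W. S \<omega> \<notin> ereal ` M \<omega>"
  proof eventually_elim
    case (elim \<omega>)
    show ?case
    proof
      assume "S \<omega> \<in> ereal ` M \<omega>"
      then obtain x where x: "x \<in> M \<omega>" "S \<omega> = ereal x" by auto
      then have "Some x \<in> {\<tau> s t \<omega> | s t. s \<in> \<rat> \<and> t \<in> \<rat> \<and> s < t}" using elim(2) by blast
      then show False using elim(1) x(2) by force
    qed
  qed
  \<comment> \<open>Nothing is known in advance about the measurability of this event; it comes from
    the completeness of \<open>W\<close>.\<close>
  then have "{\<omega> \<in> space W. \<not> S \<omega> \<notin> ereal ` M \<omega>} \<in> null_sets W"
    unfolding W completion.AE_iff_null_sets .
  then show ?thesis by (simp add: null_sets_def measure_def)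
qed

end
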